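(* Let $N\ge 2$, $0<\rho<1$, and let $f_i(x)=\rho x+b_i$ ($1\le i\le N$) be maps of $\mathbb{R}$ with $0=b_1<b_2<\cdots<b_N=1-\rho$. Assume that $(f_i)_{i=1}^N$ satisfies the finite-type condition. Let $E$ be the self-similar set determined by $(f_i)_{i=1}^N$ and let $\mu$ be the self-similar measure associated with $(f_i)_{i=1}^N$ and a positive probability vector $(p_i)_{i=1}^N$. Assume that $E$ is totally self-similar. Let $r\in(0,\infty)$ and let $s_r:=D_r(\mu)$ be the quantization dimension of $\mu$ of order $r$. Then $$0<\underline{Q}_r^{s_r}(\mu)\le\overline{Q}_r^{s_r}(\mu)<\infty .$$
   Context: Words: $\mathcal{A}=\{1,\dots,N\}$, $\mathcal{A}_n=\mathcal{A}^n$ for $n\ge1$, $\mathcal{A}^*=\bigcup_{n\ge1}\mathcal{A}_n$; $f_\sigma=f_{\sigma_1}\circ\cdots\circ f_{\sigma_n}$ for $\sigma=\sigma_1\ldots\sigma_n\in\mathcal{A}_n$. Self-similar set and measure: $E$ is the unique non-empty compact set with $E=\bigcup_{i=1}^N f_i(E)$ (so $E\subset[0,1]$); $\mu$ is the unique Borel probability measure with $\mu=\sum_{i=1}^N p_i\,\mu\circ f_i^{-1}$, where all $p_i>0$ and $\sum_i p_i=1$. Finite-type condition (FTC): there is a finite set $\Gamma$ such that for every $n\ge1$ and every pair $\sigma,\omega\in\mathcal{A}_n$, either $\rho^{-n}|f_\sigma(0)-f_\omega(0)|\in\Gamma$ or $\rho^{-n}|f_\sigma(0)-f_\omega(0)|>1$.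 Total self-similarity: $E$ is totally self-similar if $f_\omega(E)=f_\omega([0,1])\cap E$ for every $\omega\in\mathcal{A}^*$. Quantization: for a Borel probability measure $\nu$ on $\mathbb{R}$ and $k\ge1$, the $k$th quantization error of order $r$ is $$e_{k,r}(\nu)=\inf\Big\{\Big(\int d(x,\alpha)^r\,d\nu(x)\Big)^{1/r}:\ \alpha\subset\mathbb{R},\ 1\le\mathrm{card}(\alpha)\le k\Big\},$$ with $d$ the Euclidean distance. For $s\in(0,\infty)$, $$\overline{Q}_r^s(\nu)=\limsup_{k\to\infty}k^{r/s}e_{k,r}^r(\nu),\qquad \underline{Q}_r^s(\nu)=\liminf_{k\to\infty}k^{r/s}e_{k,r}^r(\nu).$$ The upper and lower quantization dimensions are $\overline{D}_r(\nu)=\limsup_{k\to\infty}\frac{\log k}{-\log e_{k,r}(\nu)}$ and $\underline{D}_r(\nu)=\liminf_{k\to\infty}\frac{\log k}{-\log e_{k,r}(\nu)}$; when they agree, the common value is the quantization dimension $D_r(\nu)$. It is known from earlier work that $D_r(\mu)$ exists for every self-similar measure $\mu$. *)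

theory Defs
  imports "HOL-Probability.Probability"
begin

definition words :: "nat \<Rightarrow> nat \<Rightarrow> nat list set" where
  "words N n = {\<sigma>. length \<sigma> = n \<and> set \<sigma> \<subseteq> {1..N}}"

definition word_map :: "(nat \<Rightarrow> real \<Rightarrow> real) \<Rightarrow> nat list \<Rightarrow> real \<Rightarrow> real" where
  "word_map f \<sigma> = foldr (\<lambda>i g. f i \<circ> g) \<sigma> id"

definition finite_type :: "nat \<Rightarrow> real \<Rightarrow> (nat \<Rightarrow> real \<Rightarrow> real) \<Rightarrow> bool" where
  "finite_type N \<rho> f \<longleftrightarrow>
     (\<exists>\<Gamma>::real set. finite \<Gamma> \<and>
        (\<forall>n\<ge>1. \<forall>\<sigma>\<in>words N n. \<forall>\<omega>\<in>words N n.
           \<bar>word_map f \<sigma> 0 - word_map f \<omega> 0\<bar> / \<rho> ^ n \<in> \<Gamma> \<or>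
           \<bar>word_map f \<sigma> 0 - word_map f \<omega> 0\<bar> / \<rho> ^ n > 1))"

definition self_similar_set :: "nat \<Rightarrow> (nat \<Rightarrow> real \<Rightarrow> real) \<Rightarrow> real set \<Rightarrow> bool" where
  "self_similar_set N f E \<longleftrightarrow> E \<noteq> {} \<and> compact E \<and> E = (\<Union>i\<in>{1..N}. f i ` E)"

definition self_similar_measure ::
  "nat \<Rightarrow> (nat \<Rightarrow> real \<Rightarrow> real) \<Rightarrow> (nat \<Rightarrow> real) \<Rightarrow> real measure \<Rightarrow> bool" where
  "self_similar_measure N f p \<mu> \<longleftrightarrow>
     prob_space \<mu> \<and> sets \<mu> = sets borel \<and>
     (\<forall>A\<in>sets borel. measure \<mu> A = (\<Sum>i\<in>{1..N}. p i * measure \<mu> (f i -` A)))"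

definition totally_self_similar :: "nat \<Rightarrow> (nat \<Rightarrow> real \<Rightarrow> real) \<Rightarrow> real set \<Rightarrow> bool" where
  "totally_self_similar N f E \<longleftrightarrow>
     (\<forall>n\<ge>1. \<forall>\<omega>\<in>words N n. word_map f \<omega> ` E = word_map f \<omega> ` {0..1} \<inter> E)"

(* The Bochner integral agrees with the [0,\<infinity>]-valued one when \<nu> has a finite r-th moment;
   without that it is 0 by convention, and the definition is not meant to be used. *)
definition quantization_error :: "nat \<Rightarrow> real \<Rightarrow> real measure \<Rightarrow> real" where
  "quantization_error k r \<nu> =
     (INF \<alpha>\<in>{\<alpha>. finite \<alpha> \<and> 1 \<le> card \<alpha> \<and> card \<alpha> \<le> k}.
        (LINT x|\<nu>. infdist x \<alpha> powr r) powr (1 / r))"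

definition upper_quantization_coeff :: "real \<Rightarrow> real \<Rightarrow> real measure \<Rightarrow> ereal" where
  "upper_quantization_coeff r s \<nu> =
     limsup (\<lambda>k. ereal (real k powr (r / s) * quantization_error k r \<nu> powr r))"

definition lower_quantization_coeff :: "real \<Rightarrow> real \<Rightarrow> real measure \<Rightarrow> ereal" where
  "lower_quantization_coeff r s \<nu> =
     liminf (\<lambda>k. ereal (real k powr (r / s) * quantization_error k r \<nu> powr r))"

(* If the error is 0, then ln 0 = 0 and x / 0 = 0 give the value 0, as does the usual
   reading of ln k / \<infinity>. *)
definition upper_quantization_dim :: "real \<Rightarrow> real measure \<Rightarrow> ereal" where
  "upper_quantization_dim r \<nu> =
     limsup (\<lambda>k. ereal (ln (real k) / - ln (quantization_error k r \<nu>)))"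

definition lower_quantization_dim :: "real \<Rightarrow> real measure \<Rightarrow> ereal" where
  "lower_quantization_dim r \<nu> =
     liminf (\<lambda>k. ereal (ln (real k) / - ln (quantization_error k r \<nu>)))"

(* Unspecified unless the two dimensions agree and are finite. *)
definition quantization_dim :: "real \<Rightarrow> real measure \<Rightarrow> real" where
  "quantization_dim r \<nu> =
     (THE s. lower_quantization_dim r \<nu> = ereal s \<and> upper_quantization_dim r \<nu> = ereal s)"

lemma quantization_dim_eqI:
  assumes "lower_quantization_dim r \<nu> = ereal s" and "upper_quantization_dim r \<nu> = ereal s"
  shows "quantization_dim r \<nu> = s"
  using assms by (simp add: quantization_dim_def)

end

theory Submission
  imports Defs
begin

text \<open>
Call the interval \<open>f\<^sub>\<sigma>[0,1] = [a, a + \<rho>\<^sup>n]\<close> of a word \<open>\<sigma>\<close> of length \<open>n\<close> a piece of level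
\<open>n\<close>; it is determined by \<open>n\<close> and \<open>a = f\<^sub>\<sigma>(0)\<close>. Different words may give the same piece, so give the
piece the weight \<open>wt n a = \<Sum> \<rho>\<^bsup>nr\<^esup> p\<^sub>\<sigma>\<close>, summed over all words that produce it. Up to constants this is
what the piece contributes to the \<open>r\<close>-th power of the quantization error if it is served by a single
point. Everything rests on counting the pieces with weight about \<open>\<epsilon>\<close>.

Finite type says that only boundedly many pieces of level \<open>n\<close>, say \<open>M\<close>, meet a given one. Weights
form a convolution: \<open>wt (n + m)\<close> is composed of products \<open>wt n a * wt m y\<close>, and each value collects at
most \<open>M\<close> of them. Hence for \<open>0 \<le> q \<le> 1\<close> the power sums \<open>Y\<^sub>n(q) = \<Sum>\<^sub>a (wt n a)\<^sup>q\<close> satisfy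
\<open>Y\<^sub>n\<^sub>+\<^sub>m \<le> Y\<^sub>n Y\<^sub>m \<le> M Y\<^sub>n\<^sub>+\<^sub>m\<close>, and by continuity there is a critical \<open>q\<close> in \<open>(0,1)\<close> with
\<open>1 \<le> Y\<^sub>n(q) \<le> M\<close> for all \<open>n\<close> (\<open>ex_critical_exponent\<close>). It will turn out that
\<open>q = s / (s + r)\<close> with \<open>s\<close> the quantization dimension.

The crux is that only \<open>O(\<epsilon>\<^sup>-\<^sup>q)\<close> pieces of all levels together have weight at least \<open>\<epsilon>\<close>
(\<open>sum_big_bound\<close>). If heavy pieces were nested with geometrically decreasing weights, this would
follow by letting every heavy piece charge the points of a deep level below it, whose \<open>q\<close>-th powers sum
to at most \<open>M\<close>. A piece that overlaps a much heavier piece of its own level spoils this, since later pieces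
inside both may be heavier than itself. So only dominant pieces charge: those that are not much lighter
than any of their neighbours of the same level. The weights of later pieces meeting a dominant one do decrease
geometrically in the level
(\<open>dominant_controls_later\<close>), and replacing a non-dominant piece by a heavier neighbour gains a factor
so large that the dominant pieces carry at least half of the \<open>q/2\<close>-th power sum of all heavy pieces
(\<open>sum_big_le_dominant\<close>).

For the upper bound on the error, follow every word until its piece has weight below \<open>\<epsilon>\<close>; these exit
pieces are children of heavy pieces, so there are \<open>O(\<epsilon>\<^sup>-\<^sup>q)\<close> of them, and one point in each gives an
error of at most \<open>\<epsilon>\<close> per piece. For the lower bound, the same counting shows that at least a constant
times \<open>\<epsilon>\<^sup>-\<^sup>q\<close> dominant pieces have weight comparable to \<open>\<epsilon>\<close>, and domination makes their overlap bounded
(\<open>ex_separated_family\<close>). If there are sufficiently more such pieces than points, then a fixed proportion of the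
pieces contains no point, and each of these contributes a constant times \<open>\<epsilon>\<close>. With \<open>\<epsilon>\<close> of order
\<open>k\<^bsup>-1/q\<^esup>\<close> both bounds on the \<open>r\<close>-th power of the error become constants times \<open>k\<^bsup>1 - 1/q\<^esup> = k\<^bsup>-r/s\<^esup>\<close>.
Such two-sided bounds identify \<open>s\<close> as the quantization dimension
(\<open>quantization_dim_eq_of_bounds\<close>) and bound both coefficients.
\<close>

section \<open>Weights carried by the pieces of an iterated function system\<close>

text \<open>After division by the total sum every term lies in \<open>[0,1]\<close>, where \<open>x \<le> x\<^sup>q\<close>.\<close>

lemma powr_sum_le_sum_powr:
  fixes y :: "'a \<Rightarrow> real"
  assumes "finite A" and "\<And>i. i \<in> A \<Longrightarrow> 0 \<le> y i" and "0 \<le> q" and "q \<le> 1"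
  shows "(\<Sum>i\<in>A. y i) powr q \<le> (\<Sum>i\<in>A. y i powr q)"
proof (cases "(\<Sum>i\<in>A. y i) = 0")
  case True
  then show ?thesis by (simp add: sum_nonneg)
next
  case False
  define S where "S = (\<Sum>i\<in>A. y i)"
  have S: "S > 0" using False sum_nonneg[of A y] assms(2) unfolding S_def by fastforce
  have "y i / S \<le> (y i / S) powr q" if "i \<in> A" for i
  proof -
    have 0: "0 \<le> y i / S" using S assms(2) that by simp
    have 1: "y i / S \<le> 1" using S assms(1,2) that member_le_sum[of i A y] by (simp add: S_def)
    have "(y i / S) powr 1 \<le> (y i / S) powr q"
      using powr_mono'[of q 1 "y i / S"] 0 1 assms by auto
    then show ?thesis by (simp only: powr_one[OF 0])
  qed
  then have "(\<Sum>i\<in>A. y i / S) \<le> (\<Sum>i\<in>A. (y i / S) powr q)" by (rule sum_mono)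
  moreover have "(\<Sum>i\<in>A. y i / S) = 1" using S by (simp add: S_def flip: sum_divide_distrib)
  moreover have "(\<Sum>i\<in>A. (y i / S) powr q) = (\<Sum>i\<in>A. y i powr q) / S powr q"
    using S assms(2) by (simp add: powr_divide sum_divide_distrib)
  ultimately have "1 \<le> (\<Sum>i\<in>A. y i powr q) / S powr q" by simp
  then show ?thesis using S by (simp add: S_def field_simps)
qed

text \<open>The maps \<open>x \<mapsto> \<rho> x + b i\<close> with a coefficient \<open>g i\<close> attached to each. For quantization of order \<open>r\<close> one takes
\<open>g i = \<rho>\<^sup>r p i\<close>, and the sum of the coefficients is \<open>\<rho>\<^sup>r < 1\<close>.\<close>

locale weighted_translations =
  fixes N :: nat and \<rho> :: real and b g :: "nat \<Rightarrow> real"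
  assumes N_ge_2: "2 \<le> N" and \<rho>_pos: "0 < \<rho>" and \<rho>_less_1: "\<rho> < 1"
    and b_first: "b 1 = 0" and b_last: "b N = 1 - \<rho>"
    and b_bounds: "\<And>i. i \<in> {1..N} \<Longrightarrow> 0 \<le> b i \<and> b i \<le> 1 - \<rho>"
    and g_pos: "\<And>i. i \<in> {1..N} \<Longrightarrow> 0 < g i" and g_sum: "(\<Sum>i\<in>{1..N}. g i) < 1"
begin

primrec pos :: "nat \<Rightarrow> real set" where
  "pos 0 = {0}"
| "pos (Suc n) = (\<Union>i\<in>{1..N}. (\<lambda>a. a + \<rho> ^ n * b i) ` pos n)"

text \<open>The product of the coefficients along a word, summed over all words of length \<open>n\<close> that send \<open>0\<close> to
\<open>x\<close>; the recursion splits off the last letter of the word.\<close>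

primrec wt :: "nat \<Rightarrow> real \<Rightarrow> real" where
  "wt 0 x = (if x = 0 then 1 else 0)"
| "wt (Suc n) x = (\<Sum>i\<in>{1..N}. g i * wt n (x - \<rho> ^ n * b i))"

definition \<kappa> :: real where "\<kappa> = (\<Sum>i\<in>{1..N}. g i)"

lemma one_in: "1 \<in> {1..N}" and N_in: "N \<in> {1..N}"
  using N_ge_2 by auto

lemma \<kappa>_pos: "0 < \<kappa>"
  unfolding \<kappa>_def using one_in g_pos by (intro sum_pos) auto

lemma \<kappa>_less_1: "\<kappa> < 1"
  unfolding \<kappa>_def by (rule g_sum)

lemma finite_pos [simp]: "finite (pos n)"
  by (induction n) auto

lemma pos_child: "a \<in> pos n \<Longrightarrow> i \<in> {1..N} \<Longrightarrow> a + \<rho> ^ n * b i \<in> pos (Suc n)"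
  by auto

lemma pos_Suc: "a \<in> pos n \<Longrightarrow> a \<in> pos (Suc n)"
  using pos_child[OF _ one_in, of a n] by (simp only: b_first mult_zero_right add_0_right)

lemma max_in_pos: "1 - \<rho> ^ n \<in> pos n"
proof (induction n)
  case (Suc n)
  then have "1 - \<rho> ^ n + \<rho> ^ n * b N \<in> pos (Suc n)" by (rule pos_child[OF _ N_in])
  then show ?case by (simp only: b_last) (simp add: algebra_simps)
qed simp

lemma pos_bounds: "a \<in> pos n \<Longrightarrow> 0 \<le> a \<and> a \<le> 1 - \<rho> ^ n"
proof (induction n arbitrary: a)
  case (Suc n)
  then obtain i c where i: "i \<in> {1..N}" "c \<in> pos n" "a = c + \<rho> ^ n * b i" by auto
  have "\<rho> ^ n * b i \<le> \<rho> ^ n * (1 - \<rho>)" "0 \<le> \<rho> ^ n * b i"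
    using b_bounds[OF i(1)] \<rho>_pos by (auto intro!: mult_left_mono mult_nonneg_nonneg)
  with Suc.IH[OF i(2)] show ?case unfolding i(3) by (simp add: algebra_simps)
qed simp

lemma wt_nonneg [simp]: "0 \<le> wt n x"
  by (induction n arbitrary: x) (auto intro!: sum_nonneg mult_nonneg_nonneg less_imp_le[OF g_pos])

lemma wt_pos_iff: "0 < wt n x \<longleftrightarrow> x \<in> pos n"
proof (induction n arbitrary: x)
  case (Suc n)
  have "0 < wt (Suc n) x \<longleftrightarrow> (\<exists>i\<in>{1..N}. 0 < g i * wt n (x - \<rho> ^ n * b i))"
    unfolding wt.simps using sum_nonneg_eq_0_iff[of "{1..N}" "\<lambda>i. g i * wt n (x - \<rho> ^ n * b i)"]
      less_imp_le[OF g_pos] wt_nonneg sum_nonneg[of "{1..N}" "\<lambda>i. g i * wt n (x - \<rho> ^ n * b i)"]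
    by (smt (verit, best) finite_atLeastAtMost mult_nonneg_nonneg)
  also have "\<dots> \<longleftrightarrow> (\<exists>i\<in>{1..N}. x - \<rho> ^ n * b i \<in> pos n)"
    using Suc.IH g_pos by (simp add: zero_less_mult_iff) (meson g_pos atLeastAtMost_iff less_asym)
  also have "\<dots> \<longleftrightarrow> x \<in> pos (Suc n)"
    by (force simp: image_iff)
  finally show ?case .
qed simp

lemma wt_eq_0: "x \<notin> pos n \<Longrightarrow> wt n x = 0"
  using wt_pos_iff[of n x] wt_nonneg[of n x] by linarith

lemma sum_over_child:
  assumes "i \<in> {1..N}" and "\<And>y. y \<notin> pos n \<Longrightarrow> F y = (0::real)"
  shows "(\<Sum>x\<in>pos (Suc n). F (x - \<rho> ^ n * b i) * G x) = (\<Sum>a\<in>pos n. F a * G (a + \<rho> ^ n * b i))"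
proof -
  have "(\<Sum>a\<in>pos n. F a * G (a + \<rho> ^ n * b i))
      = (\<Sum>x\<in>(\<lambda>a. a + \<rho> ^ n * b i) ` pos n. F (x - \<rho> ^ n * b i) * G x)"
    by (subst sum.reindex) (auto simp: inj_on_def)
  also have "\<dots> = (\<Sum>x\<in>pos (Suc n). F (x - \<rho> ^ n * b i) * G x)"
  proof (rule sum.mono_neutral_left)
    show "\<forall>x\<in>pos (Suc n) - (\<lambda>a. a + \<rho> ^ n * b i) ` pos n. F (x - \<rho> ^ n * b i) * G x = 0"
    proof
      fix x assume "x \<in> pos (Suc n) - (\<lambda>a. a + \<rho> ^ n * b i) ` pos n"
      then have "x - \<rho> ^ n * b i \<notin> pos n"
        by (metis DiffD2 diff_add_cancel image_eqI)
      then show "F (x - \<rho> ^ n * b i) * G x = 0" using assms(2) by simp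
    qed
  qed (use assms(1) in auto)
  finally show ?thesis by simp
qed

text \<open>Whatever equals the coefficient-weighted sum of its values at the children of a piece can be pushed down to
any level. It is used both for integrals over pieces and for the weights of descendants.\<close>

lemma harmonic_expansion:
  assumes "\<And>n a. n < K \<Longrightarrow> \<Phi> n a = (\<Sum>i\<in>{1..N}. g i * \<Phi> (Suc n) (a + \<rho> ^ n * b i))"
    and "n \<le> K"
  shows "\<Phi> 0 0 = (\<Sum>a\<in>pos n. wt n a * \<Phi> n a)"
  using assms(2)
proof (induction n)
  case (Suc n)
  have "(\<Sum>x\<in>pos (Suc n). wt (Suc n) x * \<Phi> (Suc n) x)
      = (\<Sum>i\<in>{1..N}. \<Sum>x\<in>pos (Suc n). wt n (x - \<rho> ^ n * b i) * (g i * \<Phi> (Suc n) x))"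
    unfolding wt.simps sum_distrib_right by (subst sum.swap) (simp add: mult_ac)
  also have "\<dots> = (\<Sum>i\<in>{1..N}. \<Sum>a\<in>pos n. wt n a * (g i * \<Phi> (Suc n) (a + \<rho> ^ n * b i)))"
    by (intro sum.cong refl sum_over_child) (auto simp: wt_eq_0)
  also have "\<dots> = (\<Sum>a\<in>pos n. wt n a * \<Phi> n a)"
    using Suc.prems assms(1)[of n] by (subst sum.swap) (simp add: sum_distrib_left mult_ac)
  finally show ?case using Suc by simp
qed simp

text \<open>The recursion splitting off the first letter instead of the last one; this turns the weight of a fixed deep
point, as seen from its ancestors, into a harmonic function.\<close>

lemma wt_Suc_left: "wt (Suc m) y = (\<Sum>i\<in>{1..N}. g i * wt m ((y - b i) / \<rho>))"
proof (induction m arbitrary: y)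
  case 0
  then show ?case using \<rho>_pos by simp
next
  case (Suc m)
  have "wt (Suc (Suc m)) y = (\<Sum>j\<in>{1..N}. g j * wt (Suc m) (y - \<rho> ^ Suc m * b j))"
    by (rule wt.simps)
  also have "\<dots> = (\<Sum>j\<in>{1..N}. \<Sum>i\<in>{1..N}. g i * (g j * wt m ((y - b i) / \<rho> - \<rho> ^ m * b j)))"
    unfolding Suc.IH using \<rho>_pos by (simp add: sum_distrib_left field_simps)
  also have "\<dots> = (\<Sum>i\<in>{1..N}. g i * wt (Suc m) ((y - b i) / \<rho>))"
    by (subst sum.swap) (simp add: sum_distrib_left)
  finally show ?case .
qed

lemma wt_harmonic:
  assumes "n < K"
  shows "wt (K - n) ((x - a) / \<rho> ^ n)
    = (\<Sum>i\<in>{1..N}. g i * wt (K - Suc n) ((x - (a + \<rho> ^ n * b i)) / \<rho> ^ Suc n))"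
proof -
  have "K - n = Suc (K - Suc n)" using assms by simp
  moreover have "((x - a) / \<rho> ^ n - b i) / \<rho> = (x - (a + \<rho> ^ n * b i)) / \<rho> ^ Suc n" for i
    using \<rho>_pos by (simp add: field_simps)
  ultimately show ?thesis by (simp only: wt_Suc_left)
qed

lemma wt_convolution:
  assumes "n \<le> K"
  shows "wt K x = (\<Sum>a\<in>pos n. wt n a * wt (K - n) ((x - a) / \<rho> ^ n))"
  using harmonic_expansion[of K "\<lambda>n a. wt (K - n) ((x - a) / \<rho> ^ n)", OF wt_harmonic assms]
  by simp

lemma wt_mult_le:
  assumes "n \<le> K"
  shows "wt n a * wt (K - n) ((x - a) / \<rho> ^ n) \<le> wt K x"
proof (cases "a \<in> pos n")
  case True
  then show ?thesis unfolding wt_convolution[OF assms, of x]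
    by (intro member_le_sum) auto
qed (simp add: wt_eq_0)

lemma pos_append:
  assumes "n \<le> K" "a \<in> pos n" "y \<in> pos (K - n)"
  shows "a + \<rho> ^ n * y \<in> pos K"
proof -
  have "0 < wt n a * wt (K - n) ((a + \<rho> ^ n * y - a) / \<rho> ^ n)"
    using assms \<rho>_pos by (simp add: wt_pos_iff)
  also have "\<dots> \<le> wt K (a + \<rho> ^ n * y)" by (rule wt_mult_le[OF assms(1)])
  finally show ?thesis by (simp only: wt_pos_iff)
qed

text \<open>The positions of level \<open>K\<close> below a piece are a scaled copy of the positions of level \<open>K - n\<close>, and the
summand vanishes at all other positions.\<close>

lemma sum_descendants:
  assumes "n \<le> K" "a \<in> pos n" and "\<And>y. y \<notin> pos (K - n) \<Longrightarrow> F y = (0::real)"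
  shows "(\<Sum>x\<in>pos K. F ((x - a) / \<rho> ^ n)) = (\<Sum>y\<in>pos (K - n). F y)"
proof -
  have "(\<Sum>y\<in>pos (K - n). F y) = (\<Sum>x\<in>(\<lambda>y. a + \<rho> ^ n * y) ` pos (K - n). F ((x - a) / \<rho> ^ n))"
    using \<rho>_pos by (subst sum.reindex) (auto simp: inj_on_def)
  also have "\<dots> = (\<Sum>x\<in>pos K. F ((x - a) / \<rho> ^ n))"
  proof (rule sum.mono_neutral_left)
    show "\<forall>x\<in>pos K - (\<lambda>y. a + \<rho> ^ n * y) ` pos (K - n). F ((x - a) / \<rho> ^ n) = 0"
    proof
      fix x assume x: "x \<in> pos K - (\<lambda>y. a + \<rho> ^ n * y) ` pos (K - n)"
      have "x = a + \<rho> ^ n * ((x - a) / \<rho> ^ n)" using \<rho>_pos by simp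
      then have "(x - a) / \<rho> ^ n \<notin> pos (K - n)" using x by blast
      then show "F ((x - a) / \<rho> ^ n) = 0" by (rule assms(3))
    qed
  qed (use pos_append[OF assms(1,2)] in auto)
  finally show ?thesis by simp
qed

lemma sum_wt: "(\<Sum>a\<in>pos n. wt n a) = \<kappa> ^ n"
proof -
  have "\<kappa> ^ (n - 0) = (\<Sum>a\<in>pos n. wt n a * \<kappa> ^ (n - n))"
  proof (rule harmonic_expansion[of n "\<lambda>m a. \<kappa> ^ (n - m)"])
    fix m :: nat assume "m < n"
    then have "n - m = Suc (n - Suc m)" by simp
    then show "\<kappa> ^ (n - m) = (\<Sum>i\<in>{1..N}. g i * \<kappa> ^ (n - Suc m))"
      by (simp add: \<kappa>_def sum_distrib_right)
  qed simp
  then show ?thesis by simp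
qed

lemma wt_le: "wt n a \<le> \<kappa> ^ n"
proof (cases "a \<in> pos n")
  case True
  then show ?thesis using member_le_sum[of a "pos n" "wt n"] by (simp add: sum_wt)
qed (use \<kappa>_pos in \<open>simp add: wt_eq_0\<close>)

lemma ex_small_level:
  assumes "0 < \<epsilon>"
  obtains K where "\<And>n a. K \<le> n \<Longrightarrow> wt n a < \<epsilon>"
proof -
  obtain K where K: "\<kappa> ^ K < \<epsilon>" using real_arch_pow_inv[OF assms \<kappa>_less_1] by blast
  have "wt n a < \<epsilon>" if "K \<le> n" for n a
    using wt_le[of n a] power_decreasing[OF that, of \<kappa>] \<kappa>_pos \<kappa>_less_1 K by linarith
  then show ?thesis by (rule that)
qed

text \<open>Every level contains the previous one (append the letter \<open>1\<close>) and the new largest position \<open>1 - \<rho>\<^sup>n\<close>.\<close>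

lemma less_card_pos: "n < card (pos n)"
proof (induction n)
  case (Suc n)
  have "\<rho> ^ Suc n < \<rho> ^ n" using \<rho>_pos \<rho>_less_1 by simp
  then have "1 - \<rho> ^ Suc n \<notin> pos n" using pos_bounds[of "1 - \<rho> ^ Suc n" n] by linarith
  then have "pos n \<subset> pos (Suc n)" using pos_Suc max_in_pos[of "Suc n"] by blast
  then have "card (pos n) < card (pos (Suc n))" by (rule psubset_card_mono[OF finite_pos])
  with Suc show ?case by simp
qed simp

end

section \<open>Bounded overlap and the critical exponent\<close>

text \<open>Two pieces \<open>[a, a + \<rho>\<^sup>n]\<close> and \<open>[c, c + \<rho>\<^sup>n]\<close> meet iff \<open>\<bar>c - a\<bar> \<le> \<rho>\<^sup>n\<close>, so \<open>M\<close> bounds the number of pieces of one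
level that meet a given one.\<close>

locale boundedly_overlapping = weighted_translations +
  fixes M :: nat
  assumes overlap: "\<And>n a. a \<in> pos n \<Longrightarrow> card {c \<in> pos n. \<bar>c - a\<bar> \<le> \<rho> ^ n} \<le> M"
begin

lemma M_ge_1: "1 \<le> M"
proof -
  have "{c \<in> pos 0. \<bar>c - 0\<bar> \<le> \<rho> ^ 0} = {0}" by auto
  then show ?thesis using overlap[of 0 0] by simp
qed

lemma card_containing: "card {a \<in> pos n. a \<le> z \<and> z \<le> a + \<rho> ^ n} \<le> M"
proof (cases "{a \<in> pos n. a \<le> z \<and> z \<le> a + \<rho> ^ n} = {}")
  case False
  then obtain a where a: "a \<in> pos n" "a \<le> z" "z \<le> a + \<rho> ^ n" by blast
  have "card {a \<in> pos n. a \<le> z \<and> z \<le> a + \<rho> ^ n} \<le> card {c \<in> pos n. \<bar>c - a\<bar> \<le> \<rho> ^ n}"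
    using a by (intro card_mono) auto
  also have "\<dots> \<le> M" by (rule overlap[OF a(1)])
  finally show ?thesis .
next
  case True
  then show ?thesis by (simp only: card.empty)
qed

text \<open>The premise expresses that the piece of level \<open>n + m\<close> at \<open>x\<close> is a descendant of the piece of level \<open>n\<close> at \<open>a\<close>.\<close>

lemma descendant_bounds:
  assumes "(x - a) / \<rho> ^ n \<in> pos m"
  shows "a \<le> x" and "x + \<rho> ^ (n + m) \<le> a + \<rho> ^ n"
proof -
  have r: "0 < \<rho> ^ n" using \<rho>_pos by simp
  from pos_bounds[OF assms] have "0 \<le> (x - a) / \<rho> ^ n" "(x - a) / \<rho> ^ n \<le> 1 - \<rho> ^ m" by auto
  then have "0 \<le> x - a" "x - a \<le> (1 - \<rho> ^ m) * \<rho> ^ n"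
    using r by (auto simp: zero_le_divide_iff pos_divide_le_eq)
  then show "a \<le> x" "x + \<rho> ^ (n + m) \<le> a + \<rho> ^ n" by (auto simp: algebra_simps power_add)
qed

lemma descendant_mem:
  assumes "(x - a) / \<rho> ^ n \<in> pos m"
  shows "a \<le> x \<and> x \<le> a + \<rho> ^ n"
  using descendant_bounds[OF assms] zero_less_power[OF \<rho>_pos, of "n + m"] by linarith

definition power_sum :: "real \<Rightarrow> nat \<Rightarrow> real" where
  "power_sum q n = (\<Sum>a\<in>pos n. wt n a powr q)"

lemma power_sum_0 [simp]: "power_sum q 0 = 1"
  by (simp add: power_sum_def)

lemma power_sum_nonneg: "0 \<le> power_sum q n"
  by (simp add: power_sum_def sum_nonneg)

lemma power_sum_mult:
  "power_sum q n * power_sum q m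
    = (\<Sum>x\<in>pos (n + m). \<Sum>a\<in>pos n. (wt n a * wt m ((x - a) / \<rho> ^ n)) powr q)"
proof -
  have "(\<Sum>x\<in>pos (n + m). wt m ((x - a) / \<rho> ^ n) powr q) = power_sum q m" if "a \<in> pos n" for a
    using sum_descendants[of n "n + m" a "\<lambda>y. wt m y powr q"] that
    by (simp add: wt_eq_0 power_sum_def)
  then have "power_sum q n * power_sum q m
      = (\<Sum>a\<in>pos n. wt n a powr q * (\<Sum>x\<in>pos (n + m). wt m ((x - a) / \<rho> ^ n) powr q))"
    by (simp add: power_sum_def[of q n] sum_distrib_right)
  also have "\<dots> = (\<Sum>x\<in>pos (n + m). \<Sum>a\<in>pos n. (wt n a * wt m ((x - a) / \<rho> ^ n)) powr q)"
    by (subst sum.swap) (simp add: sum_distrib_left powr_mult)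
  finally show ?thesis .
qed

text \<open>Subadditivity of the \<open>q\<close>-th power, applied to the convolution formula for the weights.\<close>

lemma power_sum_submult:
  assumes "0 \<le> q" "q \<le> 1"
  shows "power_sum q (n + m) \<le> power_sum q n * power_sum q m"
  unfolding power_sum_mult power_sum_def[of q "n + m"]
proof (rule sum_mono)
  fix x
  show "wt (n + m) x powr q \<le> (\<Sum>a\<in>pos n. (wt n a * wt m ((x - a) / \<rho> ^ n)) powr q)"
    unfolding wt_convolution[of n "n + m", OF le_add1] diff_add_inverse
    by (rule powr_sum_le_sum_powr) (use assms in auto)
qed

text \<open>A position of level \<open>n + m\<close> lies in at most \<open>M\<close> pieces of level \<open>n\<close>, and each single product in the
convolution formula is at most the whole weight.\<close>

lemma power_sum_supermult:
  assumes "0 \<le> q"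
  shows "power_sum q n * power_sum q m \<le> M * power_sum q (n + m)"
  unfolding power_sum_mult power_sum_def[of q "n + m"] sum_distrib_left
proof (rule sum_mono)
  fix x
  let ?S = "{a \<in> pos n. a \<le> x \<and> x \<le> a + \<rho> ^ n}"
  have "(\<Sum>a\<in>pos n. (wt n a * wt m ((x - a) / \<rho> ^ n)) powr q)
      = (\<Sum>a\<in>?S. (wt n a * wt m ((x - a) / \<rho> ^ n)) powr q)"
  proof (rule sum.mono_neutral_right)
    show "\<forall>a\<in>pos n - ?S. (wt n a * wt m ((x - a) / \<rho> ^ n)) powr q = 0"
      using descendant_mem[of x _ n m] wt_eq_0[of _ m] by auto
  qed auto
  also have "\<dots> \<le> (\<Sum>a\<in>?S. wt (n + m) x powr q)"
    using wt_mult_le[of n "n + m" _ x] assms by (intro sum_mono powr_mono2) auto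
  also have "\<dots> \<le> M * wt (n + m) x powr q"
    using card_containing[of n x] by (simp add: mult_right_mono)
  finally show "(\<Sum>a\<in>pos n. (wt n a * wt m ((x - a) / \<rho> ^ n)) powr q) \<le> M * wt (n + m) x powr q" .
qed

lemma power_sum_power_le:
  assumes "0 \<le> q" "q \<le> 1"
  shows "power_sum q (k * n) \<le> power_sum q n ^ k"
proof (induction k)
  case (Suc k)
  have "power_sum q (Suc k * n) \<le> power_sum q n * power_sum q (k * n)"
    using power_sum_submult[OF assms, of n "k * n"] by simp
  also have "\<dots> \<le> power_sum q n * power_sum q n ^ k"
    by (rule mult_left_mono[OF Suc power_sum_nonneg])
  finally show ?case by simp
qed simp

lemma power_sum_power_ge:
  assumes "0 \<le> q"
  shows "power_sum q n ^ Suc k \<le> M ^ k * power_sum q (Suc k * n)"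
proof (induction k)
  case (Suc k)
  have "power_sum q n ^ Suc (Suc k) \<le> power_sum q n * (M ^ k * power_sum q (Suc k * n))"
    using mult_left_mono[OF Suc power_sum_nonneg[of q n]] by simp
  also have "\<dots> = M ^ k * (power_sum q n * power_sum q (Suc k * n))" by simp
  also have "\<dots> \<le> M ^ k * (M * power_sum q (n + Suc k * n))"
    by (rule mult_left_mono[OF power_sum_supermult[OF assms]]) simp
  finally show ?case by (simp add: mult_ac)
qed simp

text \<open>Past the threshold \<open>M\<close> supermultiplicativity forces exponential growth along the multiples of \<open>n\<close>, whereas a
single value below one would force decay by submultiplicativity; compare at level \<open>m n\<close>.\<close>

lemma power_sum_ge_1:
  assumes q: "0 \<le> q" "q \<le> 1" and n: "M < power_sum q n"
  shows "1 \<le> power_sum q m"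
proof (rule ccontr)
  assume m: "\<not> 1 \<le> power_sum q m"
  then obtain k where k: "m = Suc k" by (cases m) auto
  have M: "1 \<le> real M" using M_ge_1 by simp
  have "0 < n" using n M by (cases n) auto
  then have "power_sum q (m * n) < 1"
    using power_sum_power_le[OF q, of n m] power_less_one_iff[of "power_sum q m" n]
      power_sum_nonneg[of q m] m by (simp add: mult.commute)
  then have "power_sum q (Suc k * n) \<le> 1" unfolding k by (rule less_imp_le)
  then have "real M ^ k * power_sum q (Suc k * n) \<le> real M ^ k * 1"
    by (rule mult_left_mono) simp
  also have "\<dots> \<le> real M ^ Suc k" using M by simp
  also have "\<dots> < power_sum q n ^ Suc k"
    using n M by (intro power_strict_mono) auto
  also have "\<dots> \<le> real M ^ k * power_sum q (Suc k * n)"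
    using power_sum_power_ge[OF q(1), of n k] by simp
  finally show False by simp
qed

lemma continuous_power_sum: "continuous_on A (\<lambda>q. power_sum q n)"
  unfolding power_sum_def
proof (intro continuous_on_sum)
  fix a assume "a \<in> pos n"
  then show "continuous_on A (\<lambda>q. wt n a powr q)"
    using wt_pos_iff[of n a] by (intro continuous_on_powr continuous_intros) auto
qed

lemma power_sum_near:
  assumes "K < power_sum q n" "q < u"
  obtains q' where "q < q'" "q' < u" "K < power_sum q' n"
proof -
  have "isCont (\<lambda>q. power_sum q n) q"
    using continuous_power_sum[of UNIV n] by (simp add: continuous_on_eq_continuous_at)
  then have "\<forall>\<^sub>F q' in at q. K < power_sum q' n"
    using assms(1) by (simp add: isCont_def order_tendsto_iff)
  then obtain d where d: "0 < d" "\<And>q'. q' \<noteq> q \<Longrightarrow> dist q' q < d \<Longrightarrow> K < power_sum q' n"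
    by (auto simp: eventually_at)
  define e where "e = min (d / 2) ((u - q) / 2)"
  have e: "0 < e" "e < d" "e < u - q"
    using d(1) assms(2) by (auto simp: e_def min_def field_simps)
  with d(2)[of "q + e"] have "K < power_sum (q + e) n" by (simp add: dist_real_def)
  then show ?thesis using e by (intro that[of "q + e"]) auto
qed

text \<open>Take the largest \<open>q\<close> for which no power sum is below one. A power sum above \<open>M\<close> would stay above \<open>M\<close> slightly
to the right of \<open>q\<close>, which contradicts maximality by \<open>power_sum_ge_1\<close>. At \<open>q = 0\<close> the power sums count
positions and are unbounded, so \<open>q > 0\<close>; at \<open>q = 1\<close> they are \<open>\<kappa>\<^sup>n < 1\<close>, so \<open>q < 1\<close>.\<close>

lemma ex_critical_exponent:
  obtains q where "0 < q" "q < 1" "\<And>n. 1 \<le> power_sum q n \<and> power_sum q n \<le> M"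
proof -
  define Q where "Q = {0..1} \<inter> (\<Inter>n. {q. 1 \<le> power_sum q n})"
  have Q_I: "q \<in> Q" if "0 \<le> q" "q \<le> 1" "M < power_sum q n" for q n
    using power_sum_ge_1[OF that] that by (auto simp: Q_def)
  have "closed Q" unfolding Q_def
    by (intro closed_Int closed_INT ballI closed_Collect_le continuous_power_sum) auto
  then have "compact Q"
    unfolding compact_eq_bounded_closed using bounded_subset[OF bounded_closed_interval[of 0 1], of Q]
    by (auto simp: Q_def)
  have "power_sum 0 M = card (pos M)"
  proof -
    have "wt M a powr 0 = 1" if "a \<in> pos M" for a
      using wt_pos_iff[of M a] that by simp
    then show ?thesis by (simp add: power_sum_def)
  qed
  then have M0: "M < power_sum 0 M" using less_card_pos[of M] by simp
  then obtain q0 where q0: "0 < q0" "q0 < 1" "M < power_sum q0 M"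
    using power_sum_near[of M 0 M 1] by auto
  then have "q0 \<in> Q" using Q_I[of q0 M] by simp
  then obtain q where q: "q \<in> Q" "\<And>q'. q' \<in> Q \<Longrightarrow> q' \<le> q"
    using compact_attains_sup[of Q] \<open>compact Q\<close> by blast
  have "0 < q" using q(2)[OF \<open>q0 \<in> Q\<close>] q0(1) by linarith
  have "power_sum 1 1 = \<kappa>" unfolding power_sum_def powr_one[OF wt_nonneg] sum_wt by simp
  then have "1 \<notin> Q" using \<kappa>_less_1 unfolding Q_def by (metis INT_iff IntD2 UNIV_I linorder_not_le mem_Collect_eq)
  moreover have "q \<le> 1" using q(1) by (simp add: Q_def)
  ultimately have "q < 1" using q(1) by (cases "q = 1") auto
  have "power_sum q n \<le> M" for n
  proof (rule ccontr)
    assume "\<not> power_sum q n \<le> M"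
    then obtain q' where q': "q < q'" "q' < 1" "M < power_sum q' n"
      using power_sum_near[of M q n 1] \<open>q < 1\<close> by auto
    then have "q' \<in> Q" using Q_I[of q' n] \<open>0 < q\<close> by simp
    then show False using q(2)[of q'] q'(1) by simp
  qed
  then show ?thesis using that[of q] \<open>0 < q\<close> \<open>q < 1\<close> q(1) by (auto simp: Q_def)
qed

end

section \<open>Stopping a piece when its weight drops below a threshold\<close>

context weighted_translations
begin

definition big :: "real \<Rightarrow> (nat \<times> real) set" where
  "big \<epsilon> = {(n, a). a \<in> pos n \<and> \<epsilon> \<le> wt n a}"

text \<open>The light children of heavy pieces: the pieces at which a word first becomes light.\<close>

definition exits :: "real \<Rightarrow> (nat \<times> real) set" where
  "exits \<epsilon> = (\<lambda>((n, a), i). (Suc n, a + \<rho> ^ n * b i)) ` (big \<epsilon> \<times> {1..N}) - big \<epsilon>"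

lemma finite_big:
  assumes "0 < \<epsilon>"
  shows "finite (big \<epsilon>)"
proof -
  obtain K where K: "\<And>n a. K \<le> n \<Longrightarrow> wt n a < \<epsilon>" using ex_small_level[OF assms] by blast
  have "big \<epsilon> \<subseteq> (SIGMA n:{..K}. pos n)"
  proof clarify
    fix n a assume "(n, a) \<in> big \<epsilon>"
    then show "n \<in> {..K} \<and> a \<in> pos n" using K[of n a] by (cases "n \<le> K") (auto simp: big_def)
  qed
  then show ?thesis by (rule finite_subset) auto
qed

lemma finite_exits: "0 < \<epsilon> \<Longrightarrow> finite (exits \<epsilon>)"
  by (simp add: exits_def finite_big)

lemma card_exits_le:
  assumes "0 < \<epsilon>"
  shows "card (exits \<epsilon>) \<le> N * card (big \<epsilon>)"
proof -
  have "card (exits \<epsilon>) \<le> card ((\<lambda>((n, a), i). (Suc n, a + \<rho> ^ n * b i)) ` (big \<epsilon> \<times> {1..N}))"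
    unfolding exits_def using finite_big[OF assms] by (intro card_mono) auto
  also have "\<dots> \<le> card (big \<epsilon> \<times> {1..N})"
    using finite_big[OF assms] by (intro card_image_le) auto
  finally show ?thesis by (simp add: card_cartesian_product mult.commute)
qed

lemma exitsD:
  assumes "(n, a) \<in> exits \<epsilon>"
  shows "a \<in> pos n" and "wt n a < \<epsilon>"
proof -
  obtain m c i where *: "n = Suc m" "a = c + \<rho> ^ m * b i" "(m, c) \<in> big \<epsilon>" "i \<in> {1..N}"
    and nb: "(n, a) \<notin> big \<epsilon>"
    using assms by (auto simp: exits_def)
  show a: "a \<in> pos n" using * pos_child[of c m i] by (simp add: big_def del: pos.simps)
  show "wt n a < \<epsilon>" using a nb by (simp add: big_def not_le)
qed

text \<open>Descend from the root level by level: a child of a heavy piece is heavy again, and is followed further, or it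
is an exit. A child receives mass from its heavy parents only, hence at most its full weight, whence an inequality.\<close>

lemma exit_expansion:
  assumes \<epsilon>: "0 < \<epsilon>" "\<epsilon> \<le> 1"
    and harm: "\<And>n a. n < K \<Longrightarrow> \<Phi> n a = (\<Sum>i\<in>{1..N}. g i * \<Phi> (Suc n) (a + \<rho> ^ n * b i))"
    and nonneg: "\<And>n a. 0 \<le> \<Phi> n a"
    and small: "\<And>n a. K \<le> n \<Longrightarrow> wt n a < \<epsilon>"
  shows "\<Phi> 0 0 \<le> (\<Sum>(n, a)\<in>exits \<epsilon>. wt n a * \<Phi> n a)"
proof -
  define E where "E m = {a. (m, a) \<in> exits \<epsilon>}" for m
  define B where "B m = {a \<in> pos m. \<epsilon> \<le> wt m a}" for m
  have fin: "finite (E m)" "finite (B m)" for m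
    using exitsD(1) by (auto simp: B_def E_def intro: finite_subset[OF _ finite_pos[of m]])
  have "\<Phi> 0 0 \<le> (\<Sum>m\<le>L. \<Sum>a\<in>E m. wt m a * \<Phi> m a) + (\<Sum>a\<in>B L. wt L a * \<Phi> L a)"
    if "L \<le> K" for L
    using that
  proof (induction L)
    case 0
    have "B 0 = {0}" using \<epsilon> by (auto simp: B_def)
    then show ?case using nonneg by (simp add: sum_nonneg)
  next
    case (Suc L)
    \<comment> \<open>\<open>F\<close> is the mass still descending at level \<open>L\<close>, and \<open>C\<close> are the positions which it reaches next.\<close>
    define F where "F y = (if y \<in> B L then wt L y else 0)" for y
    define C where "C = (\<Union>i\<in>{1..N}. (\<lambda>a. a + \<rho> ^ L * b i) ` B L)"
    have C: "C \<subseteq> pos (Suc L)" unfolding C_def B_def by auto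
    have "(\<Sum>a\<in>B L. wt L a * \<Phi> L a) = (\<Sum>a\<in>pos L. F a * \<Phi> L a)"
      by (rule sum.mono_neutral_cong_left) (auto simp: F_def B_def)
    also have "\<dots> = (\<Sum>i\<in>{1..N}. \<Sum>a\<in>pos L. F a * (g i * \<Phi> (Suc L) (a + \<rho> ^ L * b i)))"
      using harm[of L] Suc.prems by (subst sum.swap) (simp add: sum_distrib_left mult_ac)
    also have "\<dots> = (\<Sum>i\<in>{1..N}. \<Sum>x\<in>pos (Suc L). F (x - \<rho> ^ L * b i) * (g i * \<Phi> (Suc L) x))"
      by (intro sum.cong refl sum_over_child[symmetric]) (auto simp: F_def B_def)
    also have "\<dots> = (\<Sum>x\<in>pos (Suc L). (\<Sum>i\<in>{1..N}. g i * F (x - \<rho> ^ L * b i)) * \<Phi> (Suc L) x)"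
      by (subst sum.swap) (simp add: sum_distrib_left sum_distrib_right mult_ac)
    also have "\<dots> = (\<Sum>x\<in>C. (\<Sum>i\<in>{1..N}. g i * F (x - \<rho> ^ L * b i)) * \<Phi> (Suc L) x)"
    proof (rule sum.mono_neutral_right)
      show "\<forall>x\<in>pos (Suc L) - C. (\<Sum>i\<in>{1..N}. g i * F (x - \<rho> ^ L * b i)) * \<Phi> (Suc L) x = 0"
      proof
        fix x assume x: "x \<in> pos (Suc L) - C"
        have "x - \<rho> ^ L * b i \<notin> B L" if "i \<in> {1..N}" for i
        proof
          assume "x - \<rho> ^ L * b i \<in> B L"
          then have "(x - \<rho> ^ L * b i) + \<rho> ^ L * b i \<in> C" unfolding C_def using that by blast
          then show False using x by simp
        qed
        then have "(\<Sum>i\<in>{1..N}. g i * F (x - \<rho> ^ L * b i)) = 0" by (intro sum.neutral) (auto simp: F_def)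
        then show "(\<Sum>i\<in>{1..N}. g i * F (x - \<rho> ^ L * b i)) * \<Phi> (Suc L) x = 0" by simp
      qed
    qed (use C in auto)
    also have "\<dots> \<le> (\<Sum>x\<in>C. wt (Suc L) x * \<Phi> (Suc L) x)"
      unfolding wt.simps
      by (intro sum_mono mult_right_mono nonneg mult_left_mono less_imp_le[OF g_pos]) (auto simp: F_def)
    also have "\<dots> \<le> (\<Sum>x\<in>E (Suc L) \<union> B (Suc L). wt (Suc L) x * \<Phi> (Suc L) x)"
    proof (rule sum_mono2)
      show "C \<subseteq> E (Suc L) \<union> B (Suc L)"
      proof
        fix x assume x: "x \<in> C"
        then obtain i a where ia: "i \<in> {1..N}" "a \<in> B L" "x = a + \<rho> ^ L * b i" by (auto simp: C_def)
        then have "((L, a), i) \<in> big \<epsilon> \<times> {1..N}" by (simp add: big_def B_def)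
        then have "(Suc L, x) \<in> (\<lambda>((n, a), i). (Suc n, a + \<rho> ^ n * b i)) ` (big \<epsilon> \<times> {1..N})"
          by (rule rev_image_eqI) (simp add: ia)
        then show "x \<in> E (Suc L) \<union> B (Suc L)"
          using x C by (auto simp: E_def exits_def B_def big_def simp del: pos.simps wt.simps)
      qed
      show "0 \<le> wt (Suc L) x * \<Phi> (Suc L) x" for x
        by (intro mult_nonneg_nonneg wt_nonneg nonneg)
    qed (use fin in simp)
    also have "\<dots> = (\<Sum>x\<in>E (Suc L). wt (Suc L) x * \<Phi> (Suc L) x) + (\<Sum>x\<in>B (Suc L). wt (Suc L) x * \<Phi> (Suc L) x)"
    proof (rule sum.union_disjoint)
      show "E (Suc L) \<inter> B (Suc L) = {}"
        using exitsD(2) by (fastforce simp: E_def B_def simp del: pos.simps wt.simps)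
    qed (use fin in auto)
    finally show ?case using Suc by simp
  qed
  from this[of K] have "\<Phi> 0 0 \<le> (\<Sum>m\<le>K. \<Sum>a\<in>E m. wt m a * \<Phi> m a) + (\<Sum>a\<in>B K. wt K a * \<Phi> K a)"
    by simp
  also have "B K = {}" using small[of K] by (force simp: B_def not_le)
  also have "(\<Sum>m\<le>K. \<Sum>a\<in>E m. wt m a * \<Phi> m a) = (\<Sum>(m, a)\<in>(SIGMA m:{..K}. E m). wt m a * \<Phi> m a)"
    using fin by (intro sum.Sigma) auto
  also have "\<dots> \<le> (\<Sum>(m, a)\<in>exits \<epsilon>. wt m a * \<Phi> m a)"
    using nonneg by (intro sum_mono2 finite_exits \<epsilon>(1)) (auto simp: E_def)
  finally show ?thesis by simp
qed

lemma exits_level_le: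
  assumes "(n, a) \<in> exits \<epsilon>" and small: "\<And>n a. K \<le> n \<Longrightarrow> wt n a < \<epsilon>"
  shows "n \<le> K"
proof -
  obtain m c where *: "n = Suc m" "(m, c) \<in> big \<epsilon>"
    using assms by (auto simp: exits_def)
  then have "\<not> K \<le> m" using small[of m c] by (auto simp: big_def)
  then show ?thesis using * by simp
qed

end

locale critical_exponent = boundedly_overlapping +
  fixes q :: real
  assumes q_pos: "0 < q" and q_less_1: "q < 1"
    and power_sum_lower: "\<And>n. 1 \<le> power_sum q n" and power_sum_upper: "\<And>n. power_sum q n \<le> M"
begin

text \<open>Express the weights of a deep level through the exits above it. By subadditivity each exit accounts for at most
\<open>\<epsilon>\<^sup>q M\<close> of the power sum, which is at least one.\<close>

lemma card_exits_ge:
  assumes "0 < \<epsilon>" "\<epsilon> \<le> 1"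
  shows "\<epsilon> powr (- q) \<le> M * card (exits \<epsilon>)"
proof -
  obtain K where K: "\<And>n a. K \<le> n \<Longrightarrow> wt n a < \<epsilon>" using ex_small_level[OF assms(1)] by blast
  have "1 \<le> (\<Sum>x\<in>pos K. wt K x powr q)"
    using power_sum_lower[of K] by (simp add: power_sum_def)
  also have "\<dots> \<le> (\<Sum>x\<in>pos K. \<Sum>(n, a)\<in>exits \<epsilon>. wt n a powr q * wt (K - n) ((x - a) / \<rho> ^ n) powr q)"
  proof (rule sum_mono)
    fix x
    have "wt K x \<le> (\<Sum>(n, a)\<in>exits \<epsilon>. wt n a * wt (K - n) ((x - a) / \<rho> ^ n))"
      using exit_expansion[where \<Phi> = "\<lambda>n a. wt (K - n) ((x - a) / \<rho> ^ n)" and K = K, OF assms wt_harmonic _ K]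
      by simp
    then have "wt K x powr q \<le> (\<Sum>(n, a)\<in>exits \<epsilon>. wt n a * wt (K - n) ((x - a) / \<rho> ^ n)) powr q"
      using q_pos by (intro powr_mono2) auto
    also have "\<dots> \<le> (\<Sum>u\<in>exits \<epsilon>. (case u of (n, a) \<Rightarrow> wt n a * wt (K - n) ((x - a) / \<rho> ^ n)) powr q)"
      using q_pos q_less_1 finite_exits[OF assms(1)] by (intro powr_sum_le_sum_powr) auto
    also have "\<dots> = (\<Sum>(n, a)\<in>exits \<epsilon>. wt n a powr q * wt (K - n) ((x - a) / \<rho> ^ n) powr q)"
      by (intro sum.cong) (auto simp: powr_mult)
    finally show "wt K x powr q \<le> (\<Sum>(n, a)\<in>exits \<epsilon>. wt n a powr q * wt (K - n) ((x - a) / \<rho> ^ n) powr q)" .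
  qed
  also have "\<dots> = (\<Sum>(n, a)\<in>exits \<epsilon>. wt n a powr q * (\<Sum>x\<in>pos K. wt (K - n) ((x - a) / \<rho> ^ n) powr q))"
    by (subst sum.swap) (simp add: sum_distrib_left case_prod_unfold)
  also have "\<dots> \<le> (\<Sum>(n, a)\<in>exits \<epsilon>. \<epsilon> powr q * M)"
  proof (rule sum_mono, clarify)
    fix n a assume u: "(n, a) \<in> exits \<epsilon>"
    have "(\<Sum>x\<in>pos K. wt (K - n) ((x - a) / \<rho> ^ n) powr q) = power_sum q (K - n)"
      unfolding power_sum_def
      using exits_level_le[OF u K] exitsD(1)[OF u] by (intro sum_descendants) (auto simp: wt_eq_0)
    then show "wt n a powr q * (\<Sum>x\<in>pos K. wt (K - n) ((x - a) / \<rho> ^ n) powr q) \<le> \<epsilon> powr q * M"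
      using exitsD(2)[OF u] q_pos power_sum_upper[of "K - n"] power_sum_nonneg[of q "K - n"]
      by (intro mult_mono powr_mono2) auto
  qed
  also have "\<dots> = card (exits \<epsilon>) * (\<epsilon> powr q * M)" by (simp add: case_prod_unfold)
  finally show ?thesis using assms(1) by (simp add: powr_minus field_simps)
qed

text \<open>This ratio is chosen such that passing to a neighbour heavier by the factor \<open>\<Lambda>\<close> multiplies the \<open>q/2\<close>-th
power of the weight by \<open>2 M\<close>, twice the number of pieces that can share this neighbour.\<close>

definition \<Lambda> :: real where "\<Lambda> = (2 * M) powr (2 / q)"

definition dominant :: "nat \<Rightarrow> real \<Rightarrow> bool" where
  "dominant n a \<longleftrightarrow> a \<in> pos n \<and> (\<forall>c\<in>pos n. \<bar>c - a\<bar> \<le> \<rho> ^ n \<longrightarrow> wt n c \<le> \<Lambda> * wt n a)"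

lemma \<Lambda>_powr: "\<Lambda> powr (q / 2) = 2 * M"
  using q_pos M_ge_1 by (simp add: \<Lambda>_def powr_powr)

lemma \<Lambda>_pos: "0 < \<Lambda>"
  using M_ge_1 by (simp add: \<Lambda>_def)

text \<open>Let \<open>v\<close> be the position of a later piece that meets the dominant piece at \<open>a\<close>. Every ancestor of the later piece
at level \<open>n\<close> contains it, hence also meets the dominant piece. So there are at most \<open>M\<close> such ancestors, none
heavier than \<open>\<Lambda>\<close> times the dominant one.\<close>

lemma dominant_controls_later:
  assumes "n \<le> m" and dom: "dominant n a" and meet: "v \<le> a + \<rho> ^ n" "a \<le> v + \<rho> ^ m"
  shows "wt m v \<le> M * \<Lambda> * \<kappa> ^ (m - n) * wt n a"
proof -
  let ?S = "{c \<in> pos n. \<bar>c - a\<bar> \<le> \<rho> ^ n}"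
  have "wt m v = (\<Sum>c\<in>pos n. wt n c * wt (m - n) ((v - c) / \<rho> ^ n))"
    by (rule wt_convolution[OF assms(1)])
  also have "\<dots> = (\<Sum>c\<in>?S. wt n c * wt (m - n) ((v - c) / \<rho> ^ n))"
  proof (rule sum.mono_neutral_right)
    show "\<forall>c\<in>pos n - ?S. wt n c * wt (m - n) ((v - c) / \<rho> ^ n) = 0"
    proof
      fix c assume c: "c \<in> pos n - ?S"
      have "(v - c) / \<rho> ^ n \<notin> pos (m - n)"
      proof
        assume d: "(v - c) / \<rho> ^ n \<in> pos (m - n)"
        show False using descendant_bounds[OF d] meet c assms(1) by auto
      qed
      then show "wt n c * wt (m - n) ((v - c) / \<rho> ^ n) = 0" by (simp add: wt_eq_0)
    qed
  qed auto
  also have "\<dots> \<le> (\<Sum>c\<in>?S. \<Lambda> * wt n a * \<kappa> ^ (m - n))"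
    using dom \<Lambda>_pos by (intro sum_mono mult_mono wt_le) (auto simp: dominant_def)
  also have "\<dots> = card ?S * (\<Lambda> * wt n a * \<kappa> ^ (m - n))" by simp
  also have "\<dots> \<le> M * (\<Lambda> * wt n a * \<kappa> ^ (m - n))"
    using overlap[of a n] dom \<Lambda>_pos \<kappa>_pos by (intro mult_right_mono) (auto simp: dominant_def)
  finally show ?thesis by (simp add: mult_ac)
qed

definition big_dominant :: "real \<Rightarrow> (nat \<times> real) set" where
  "big_dominant \<epsilon> = {(n, a) \<in> big \<epsilon>. dominant n a}"

text \<open>Send each heavy piece that is not dominant to a neighbour heavier by more than \<open>\<Lambda>\<close>. At most \<open>M\<close> pieces are
sent to the same neighbour, so the choice of \<open>\<Lambda>\<close> makes the non-dominant pieces carry at most half of the sum.\<close>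

lemma sum_big_le_dominant:
  assumes "0 < \<epsilon>"
  shows "(\<Sum>(n, a)\<in>big \<epsilon>. wt n a powr (q / 2)) \<le> 2 * (\<Sum>(n, a)\<in>big_dominant \<epsilon>. wt n a powr (q / 2))"
proof -
  define H where "H u = (case u of (n, a) \<Rightarrow> wt n a powr (q / 2))" for u
  define U where "U = big \<epsilon> - big_dominant \<epsilon>"
  note fin = finite_big[OF assms]
  have "\<forall>u\<in>U. \<exists>c. (fst u, c) \<in> big \<epsilon> \<and> \<bar>c - snd u\<bar> \<le> \<rho> ^ fst u \<and> \<Lambda> * wt (fst u) (snd u) < wt (fst u) c"
  proof
    fix u assume u: "u \<in> U"
    obtain n a where na: "u = (n, a)" by (cases u)
    have a: "a \<in> pos n" "\<epsilon> \<le> wt n a" "\<not> dominant n a"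
      using u by (auto simp: U_def na big_dominant_def big_def)
    then obtain c where c: "c \<in> pos n" "\<bar>c - a\<bar> \<le> \<rho> ^ n" "\<Lambda> * wt n a < wt n c"
      by (auto simp: dominant_def not_le)
    have "1 \<le> \<Lambda>" unfolding \<Lambda>_def using M_ge_1 q_pos by (intro ge_one_powr_ge_zero) auto
    then have "wt n a \<le> \<Lambda> * wt n a" using mult_right_mono[of 1 \<Lambda> "wt n a"] by simp
    then have "(n, c) \<in> big \<epsilon>" using c a by (simp add: big_def)
    then show "\<exists>c. (fst u, c) \<in> big \<epsilon> \<and> \<bar>c - snd u\<bar> \<le> \<rho> ^ fst u \<and> \<Lambda> * wt (fst u) (snd u) < wt (fst u) c"
      using c na by auto
  qed
  then obtain s where s: "\<And>u. u \<in> U \<Longrightarrow> (fst u, s u) \<in> big \<epsilon>"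
    "\<And>u. u \<in> U \<Longrightarrow> \<bar>s u - snd u\<bar> \<le> \<rho> ^ fst u"
    "\<And>u. u \<in> U \<Longrightarrow> \<Lambda> * wt (fst u) (snd u) < wt (fst u) (s u)"
    by metis
  let ?s = "\<lambda>u. (fst u, s u)"
  have "(\<Sum>u\<in>U. H u) \<le> (\<Sum>u\<in>U. H (?s u) / (2 * M))"
  proof (rule sum_mono)
    fix u assume u: "u \<in> U"
    have "(\<Lambda> * wt (fst u) (snd u)) powr (q / 2) \<le> wt (fst u) (s u) powr (q / 2)"
      using s(3)[OF u] q_pos \<Lambda>_pos by (intro powr_mono2) auto
    then have "2 * M * H u \<le> H (?s u)" by (simp add: powr_mult \<Lambda>_powr H_def case_prod_unfold)
    then show "H u \<le> H (?s u) / (2 * M)" using M_ge_1 by (simp add: field_simps)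
  qed
  also have "\<dots> = (\<Sum>v\<in>big \<epsilon>. card {u \<in> U. ?s u = v} * (H v / (2 * M)))"
    by (rule sum_fun_comp[of _ _ ?s "\<lambda>v. H v / (2 * M)"]) (use fin s(1) in \<open>auto simp: U_def\<close>)
  also have "\<dots> \<le> (\<Sum>v\<in>big \<epsilon>. M * (H v / (2 * M)))"
  proof (intro sum_mono mult_right_mono)
    fix v assume v: "v \<in> big \<epsilon>"
    have "card {u \<in> U. ?s u = v} \<le> card ((\<lambda>a. (fst v, a)) ` {a \<in> pos (fst v). \<bar>a - snd v\<bar> \<le> \<rho> ^ fst v})"
    proof (rule card_mono)
      show "{u \<in> U. ?s u = v} \<subseteq> (\<lambda>a. (fst v, a)) ` {a \<in> pos (fst v). \<bar>a - snd v\<bar> \<le> \<rho> ^ fst v}"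
      proof
        fix u assume "u \<in> {u \<in> U. ?s u = v}"
        then have u: "u \<in> U" "v = ?s u" by auto
        then have "snd u \<in> pos (fst v)" by (auto simp: U_def big_def)
        moreover have "\<bar>snd u - snd v\<bar> \<le> \<rho> ^ fst v" using s(2)[OF u(1)] u(2) by simp
        ultimately show "u \<in> (\<lambda>a. (fst v, a)) ` {a \<in> pos (fst v). \<bar>a - snd v\<bar> \<le> \<rho> ^ fst v}"
          using u by (intro image_eqI[of _ _ "snd u"]) auto
      qed
    qed auto
    also have "\<dots> \<le> card {a \<in> pos (fst v). \<bar>a - snd v\<bar> \<le> \<rho> ^ fst v}"
      by (rule card_image_le) auto
    also have "\<dots> \<le> M" using v by (intro overlap) (auto simp: big_def)
    finally show "real (card {u \<in> U. ?s u = v}) \<le> real M" by simp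
  qed (auto simp: H_def)
  also have "\<dots> = (\<Sum>v\<in>big \<epsilon>. H v) / 2" using M_ge_1 by (simp add: sum_divide_distrib)
  finally have "(\<Sum>u\<in>U. H u) \<le> (\<Sum>v\<in>big \<epsilon>. H v) / 2" .
  moreover have "(\<Sum>v\<in>big \<epsilon>. H v) = (\<Sum>u\<in>U. H u) + (\<Sum>u\<in>big_dominant \<epsilon>. H u)"
    unfolding U_def by (rule sum.subset_diff) (use fin in \<open>auto simp: big_dominant_def\<close>)
  ultimately show ?thesis by (simp add: H_def)
qed

end

section \<open>Counting heavy pieces\<close>

context critical_exponent
begin

text \<open>The dominant pieces containing a given point have weights decreasing geometrically in the level, up to a constant.
So their negative powers sum to a geometric series governed by the deepest piece, whose weight is at least \<open>\<epsilon>\<close>.\<close>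

lemma sum_dominant_containing:
  assumes \<epsilon>: "0 < \<epsilon>" and S: "S \<subseteq> big_dominant \<epsilon>"
    and x: "\<And>n a. (n, a) \<in> S \<Longrightarrow> a \<le> x \<and> x \<le> a + \<rho> ^ n"
  shows "(\<Sum>(n, a)\<in>S. wt n a powr (- (q / 2)))
    \<le> M * (M * \<Lambda>) powr (q / 2) / (1 - \<kappa> powr (q / 2)) * \<epsilon> powr (- (q / 2))"
proof -
  define t where "t = q / 2"
  define c where "c = \<kappa> powr t"
  have t: "0 < t" using q_pos by (simp add: t_def)
  have c: "0 < c" "c < 1"
    using \<kappa>_pos \<kappa>_less_1 t powr_less_mono2[of t \<kappa> 1] by (auto simp: c_def)
  have MA: "0 < M * \<Lambda>" using M_ge_1 \<Lambda>_pos by simp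
  show ?thesis
  proof (cases "S = {}")
    case True
    then show ?thesis using c MA by (simp add: t_def c_def)
  next
    case False
    have fin: "finite S" using S finite_big[OF \<epsilon>] by (auto simp: big_dominant_def intro: finite_subset)
    define n0 where "n0 = Max (fst ` S)"
    have "n0 \<in> fst ` S" unfolding n0_def using fin False by (intro Max_in) auto
    then obtain a0 where a0: "(n0, a0) \<in> S" by auto
    have le: "n \<le> n0" if "(n, a) \<in> S" for n a
      unfolding n0_def using fin that by (intro Max_ge) (auto intro: rev_image_eqI)
    have power_powr: "(\<kappa> ^ k) powr t = c ^ k" for k
      by (induction k) (simp_all add: c_def powr_mult)
    define G where "G n = (M * \<Lambda>) powr t * \<epsilon> powr (- t) * c ^ (n0 - n)" for n
    have term_le: "wt n a powr (- t) \<le> G n" if na: "(n, a) \<in> S" for n a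
    proof -
      have dom: "dominant n a" using na S by (auto simp: big_dominant_def)
      have "\<epsilon> \<le> wt n0 a0" using a0 S by (auto simp: big_dominant_def big_def)
      also have "\<dots> \<le> M * \<Lambda> * \<kappa> ^ (n0 - n) * wt n a"
        using dominant_controls_later[OF le[OF na] dom] x[OF na] x[OF a0] by auto
      finally have "\<epsilon> \<le> wt n a * (M * \<Lambda> * \<kappa> ^ (n0 - n))" by (simp only: mult_ac)
      moreover have "0 < M * \<Lambda> * \<kappa> ^ (n0 - n)" using MA \<kappa>_pos by simp
      ultimately have "\<epsilon> / (M * \<Lambda> * \<kappa> ^ (n0 - n)) \<le> wt n a" by (simp only: pos_divide_le_eq)
      moreover have "0 < \<epsilon> / (M * \<Lambda> * \<kappa> ^ (n0 - n))" using \<epsilon> MA \<kappa>_pos by simp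
      ultimately have "wt n a powr (- t) \<le> (\<epsilon> / (M * \<Lambda> * \<kappa> ^ (n0 - n))) powr (- t)"
        using t by (intro powr_mono2') auto
      also have "\<dots> = (M * \<Lambda> * \<kappa> ^ (n0 - n)) powr t * \<epsilon> powr (- t)"
        using \<epsilon> MA \<kappa>_pos by (simp add: powr_divide powr_minus field_simps)
      also have "\<dots> = G n"
        by (simp add: G_def powr_mult power_powr mult_ac)
      finally show ?thesis .
    qed
    let ?C = "\<lambda>n. {a \<in> pos n. a \<le> x \<and> x \<le> a + \<rho> ^ n}"
    have "(\<Sum>(n, a)\<in>S. wt n a powr (- t)) \<le> (\<Sum>(n, a)\<in>S. G n)"
      using term_le by (intro sum_mono) auto
    also have "\<dots> \<le> (\<Sum>(n, a)\<in>(SIGMA n:{..n0}. ?C n). G n)"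
    proof (rule sum_mono2)
      show "S \<subseteq> (SIGMA n:{..n0}. ?C n)"
        using le x S by (auto simp: big_dominant_def big_def)
    qed (use c MA in \<open>auto simp: G_def\<close>)
    also have "\<dots> = (\<Sum>n\<le>n0. card (?C n) * G n)" by (simp flip: sum.Sigma)
    also have "\<dots> \<le> (\<Sum>n\<le>n0. M * G n)"
      using card_containing c by (intro sum_mono mult_right_mono) (auto simp: G_def)
    also have "\<dots> = M * (M * \<Lambda>) powr t * \<epsilon> powr (- t) * (\<Sum>n\<le>n0. c ^ (n0 - n))"
      by (simp add: G_def sum_distrib_left mult_ac)
    also have "(\<Sum>n\<le>n0. c ^ (n0 - n)) = (\<Sum>n\<le>n0. c ^ n)"
      using sum.nat_diff_reindex[of "\<lambda>k. c ^ k" "Suc n0"] by (simp add: lessThan_Suc_atMost)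
    also have "M * (M * \<Lambda>) powr t * \<epsilon> powr (- t) * (\<Sum>n\<le>n0. c ^ n)
      \<le> M * (M * \<Lambda>) powr t * \<epsilon> powr (- t) * (1 / (1 - c))"
    proof (rule mult_left_mono)
      show "(\<Sum>n\<le>n0. c ^ n) \<le> 1 / (1 - c)"
        using c by (simp add: sum_gp0 divide_right_mono)
    qed simp
    finally show ?thesis by (simp add: t_def c_def)
  qed
qed

text \<open>For a dominant piece write \<open>w\<^bsup>q/2\<^esup> = w\<^bsup>-q/2\<^esup> w\<^sup>q\<close> and distribute \<open>w\<^sup>q\<close> over the positions of a deep level \<open>K\<close> below
the piece, which is possible because power sums are at least one. A deep position \<open>x\<close> then receives at most
\<open>(wt K x)\<^sup>q\<close> times the sum over dominant pieces containing \<open>x\<close>, bounded by \<open>sum_dominant_containing\<close>, and the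
remaining sum over \<open>x\<close> is a power sum, hence at most \<open>M\<close>.\<close>

lemma sum_big_bound:
  obtains C where "0 < C"
    "\<And>\<epsilon>. 0 < \<epsilon> \<Longrightarrow> (\<Sum>(n, a)\<in>big \<epsilon>. wt n a powr (q / 2)) \<le> C * \<epsilon> powr (- (q / 2))"
proof -
  define C where "C = M * (M * \<Lambda>) powr (q / 2) / (1 - \<kappa> powr (q / 2))"
  have C: "0 < C"
    using M_ge_1 \<Lambda>_pos \<kappa>_pos \<kappa>_less_1 q_pos powr_less_mono2[of "q / 2" \<kappa> 1] by (simp add: C_def)
  show ?thesis
  proof (rule that[of "2 * (M * C)"])
    show "0 < 2 * (M * C)" using C M_ge_1 by simp
    fix \<epsilon> :: real assume \<epsilon>: "0 < \<epsilon>"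
    obtain K where K: "\<And>n a. K \<le> n \<Longrightarrow> wt n a < \<epsilon>" using ex_small_level[OF \<epsilon>] by blast
    let ?T = "\<lambda>x n a. (wt n a * wt (K - n) ((x - a) / \<rho> ^ n)) powr q"
    have "(\<Sum>(n, a)\<in>big_dominant \<epsilon>. wt n a powr (q / 2))
      \<le> (\<Sum>(n, a)\<in>big_dominant \<epsilon>. wt n a powr (- (q / 2)) * (\<Sum>x\<in>pos K. ?T x n a))"
    proof (rule sum_mono, clarify)
      fix n a assume "(n, a) \<in> big_dominant \<epsilon>"
      then have a: "a \<in> pos n" "\<epsilon> \<le> wt n a" by (auto simp: big_dominant_def big_def)
      then have "n \<le> K" using K[of n a] by (cases "n \<le> K") auto
      then have "(\<Sum>x\<in>pos K. wt (K - n) ((x - a) / \<rho> ^ n) powr q) = power_sum q (K - n)"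
        unfolding power_sum_def using a(1) by (intro sum_descendants) (auto simp: wt_eq_0)
      then have "(\<Sum>x\<in>pos K. ?T x n a) = wt n a powr q * power_sum q (K - n)"
        by (simp add: powr_mult flip: sum_distrib_left)
      then have "wt n a powr q \<le> (\<Sum>x\<in>pos K. ?T x n a)"
        using mult_left_mono[OF power_sum_lower[of "K - n"], of "wt n a powr q"] by simp
      then have "wt n a powr (- (q / 2)) * wt n a powr q \<le> wt n a powr (- (q / 2)) * (\<Sum>x\<in>pos K. ?T x n a)"
        by (rule mult_left_mono) simp
      then show "wt n a powr (q / 2) \<le> wt n a powr (- (q / 2)) * (\<Sum>x\<in>pos K. ?T x n a)"
        by (simp flip: powr_add)
    qed
    also have "\<dots> = (\<Sum>x\<in>pos K. \<Sum>(n, a)\<in>big_dominant \<epsilon>. wt n a powr (- (q / 2)) * ?T x n a)"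
      by (subst sum.swap) (simp add: sum_distrib_left case_prod_unfold)
    also have "\<dots> \<le> (\<Sum>x\<in>pos K. C * \<epsilon> powr (- (q / 2)) * wt K x powr q)"
    proof (rule sum_mono)
      fix x
      define S where "S = {(n, a) \<in> big_dominant \<epsilon>. a \<le> x \<and> x \<le> a + \<rho> ^ n}"
      have fin: "finite (big_dominant \<epsilon>)"
        using finite_big[OF \<epsilon>] by (auto simp: big_dominant_def intro: finite_subset)
      have "(\<Sum>(n, a)\<in>big_dominant \<epsilon>. wt n a powr (- (q / 2)) * ?T x n a)
        = (\<Sum>(n, a)\<in>S. wt n a powr (- (q / 2)) * ?T x n a)"
      proof (rule sum.mono_neutral_right)
        show "\<forall>u\<in>big_dominant \<epsilon> - S. (case u of (n, a) \<Rightarrow> wt n a powr (- (q / 2)) * ?T x n a) = 0"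
        proof clarify
          fix n a assume u: "(n, a) \<in> big_dominant \<epsilon>" "(n, a) \<notin> S"
          then have "(x - a) / \<rho> ^ n \<notin> pos (K - n)"
            using descendant_mem[of x a n "K - n"] by (auto simp: S_def)
          then show "wt n a powr (- (q / 2)) * ?T x n a = 0" by (simp add: wt_eq_0)
        qed
      qed (use fin in \<open>auto simp: S_def\<close>)
      also have "\<dots> \<le> (\<Sum>(n, a)\<in>S. wt n a powr (- (q / 2)) * wt K x powr q)"
      proof (rule sum_mono, clarify)
        fix n a assume "(n, a) \<in> S"
        then have "n \<le> K" using K[of n a] by (cases "n \<le> K") (auto simp: S_def big_dominant_def big_def)
        then show "wt n a powr (- (q / 2)) * ?T x n a \<le> wt n a powr (- (q / 2)) * wt K x powr q"
          using q_pos wt_mult_le[of n K a x] by (intro mult_left_mono powr_mono2) auto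
      qed
      also have "\<dots> = (\<Sum>(n, a)\<in>S. wt n a powr (- (q / 2))) * wt K x powr q"
        by (simp add: sum_distrib_right case_prod_unfold)
      also have "\<dots> \<le> C * \<epsilon> powr (- (q / 2)) * wt K x powr q"
        unfolding C_def by (intro mult_right_mono sum_dominant_containing \<epsilon>) (auto simp: S_def)
      finally show "(\<Sum>(n, a)\<in>big_dominant \<epsilon>. wt n a powr (- (q / 2)) * ?T x n a)
        \<le> C * \<epsilon> powr (- (q / 2)) * wt K x powr q" .
    qed
    also have "\<dots> = C * \<epsilon> powr (- (q / 2)) * power_sum q K"
      by (simp add: power_sum_def sum_distrib_left)
    also have "\<dots> \<le> C * \<epsilon> powr (- (q / 2)) * M"
      using C power_sum_upper[of K] by (intro mult_left_mono) auto
    finally show "(\<Sum>(n, a)\<in>big \<epsilon>. wt n a powr (q / 2)) \<le> 2 * (M * C) * \<epsilon> powr (- (q / 2))"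
      using sum_big_le_dominant[OF \<epsilon>] by (simp add: mult_ac)
  qed
qed

lemma powr_half_split:
  assumes "0 < (\<epsilon>::real)"
  shows "\<epsilon> powr (q / 2) * \<epsilon> powr (- q) = \<epsilon> powr (- (q / 2))"
    and "\<epsilon> powr (- (q / 2)) * \<epsilon> powr (- (q / 2)) = \<epsilon> powr (- q)"
  by (simp_all flip: powr_add)

lemma card_big_sum:
  assumes "0 < \<epsilon>"
  shows "\<epsilon> powr (q / 2) * card (big \<epsilon>) \<le> (\<Sum>(n, a)\<in>big \<epsilon>. wt n a powr (q / 2))"
proof -
  have "\<epsilon> powr (q / 2) * card (big \<epsilon>) = (\<Sum>(n, a)\<in>big \<epsilon>. \<epsilon> powr (q / 2))"
    by (simp add: case_prod_unfold)
  also have "\<dots> \<le> (\<Sum>(n, a)\<in>big \<epsilon>. wt n a powr (q / 2))"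
    using assms q_pos by (intro sum_mono) (auto simp: big_def intro!: powr_mono2)
  finally show ?thesis .
qed

lemma card_exits_bound:
  obtains C where "0 < C" "\<And>\<epsilon>. 0 < \<epsilon> \<Longrightarrow> card (exits \<epsilon>) \<le> C * \<epsilon> powr (- q)"
proof -
  obtain C where C: "0 < C"
    "\<And>\<epsilon>. 0 < \<epsilon> \<Longrightarrow> (\<Sum>(n, a)\<in>big \<epsilon>. wt n a powr (q / 2)) \<le> C * \<epsilon> powr (- (q / 2))"
    using sum_big_bound by blast
  show ?thesis
  proof (rule that[of "N * C"])
    show "0 < N * C" using C(1) N_ge_2 by simp
    fix \<epsilon> :: real assume \<epsilon>: "0 < \<epsilon>"
    have "\<epsilon> powr (- (q / 2)) * (\<epsilon> powr (q / 2) * card (big \<epsilon>)) \<le> \<epsilon> powr (- (q / 2)) * (C * \<epsilon> powr (- (q / 2)))"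
      using card_big_sum[OF \<epsilon>] C(2)[OF \<epsilon>] by (intro mult_left_mono) auto
    moreover have "\<epsilon> powr (- (q / 2)) * \<epsilon> powr (q / 2) = 1"
      using \<epsilon> by (simp flip: powr_add)
    ultimately have "card (big \<epsilon>) \<le> C * \<epsilon> powr (- q)"
      using powr_half_split(2)[OF \<epsilon>] by (metis mult.assoc mult.left_commute mult_1)
    then have "N * real (card (big \<epsilon>)) \<le> N * (C * \<epsilon> powr (- q))" by (rule mult_left_mono) simp
    moreover have "real (card (exits \<epsilon>)) \<le> N * real (card (big \<epsilon>))"
      using card_exits_le[OF \<epsilon>] by (metis of_nat_le_iff of_nat_mult)
    ultimately show "card (exits \<epsilon>) \<le> N * C * \<epsilon> powr (- q)" by simp
  qed
qed

text \<open>The lower bound on the number of exits makes the \<open>q/2\<close>-th power sum of heavy dominant pieces at least a constant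
times \<open>\<epsilon>\<^bsup>-q/2\<^esup>\<close>. Pieces of weight at least \<open>L \<epsilon>\<close> contribute at most \<open>C L\<^bsup>-q/2\<^esup> \<epsilon>\<^bsup>-q/2\<^esup>\<close> to it, a negligible part
for large \<open>L\<close>, so many dominant pieces have weight between \<open>\<epsilon>\<close> and \<open>L \<epsilon>\<close>. Those through a
common point occupy a bounded range of levels, because weights decrease geometrically below the one of
smallest level.\<close>

lemma ex_separated_family:
  obtains c m where "0 < c" "0 < (m::nat)"
    "\<And>\<epsilon>. 0 < \<epsilon> \<Longrightarrow> \<epsilon> \<le> 1 \<Longrightarrow> \<exists>F \<subseteq> big \<epsilon>. c * \<epsilon> powr (- q) \<le> card F \<and>
      (\<forall>z. card {(n, a) \<in> F. a \<le> z \<and> z \<le> a + \<rho> ^ n} \<le> m)"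
proof -
  define t where "t = q / 2"
  have t: "0 < t" using q_pos by (simp add: t_def)
  obtain C where C: "0 < C"
    "\<And>\<epsilon>. 0 < \<epsilon> \<Longrightarrow> (\<Sum>(n, a)\<in>big \<epsilon>. wt n a powr t) \<le> C * \<epsilon> powr (- t)"
    unfolding t_def using sum_big_bound by blast
  \<comment> \<open>The factor 4 leaves \<open>2 d\<close> for the dominant pieces, of which those heavier than \<open>L \<epsilon>\<close> take at most \<open>d\<close>.\<close>
  define d where "d = 1 / (4 * real M * N)"
  have d: "0 < d" using M_ge_1 N_ge_2 by (simp add: d_def)
  define L where "L = (C / d + 1) powr (1 / t)"
  have L1: "1 \<le> L" unfolding L_def using C(1) d t by (intro ge_one_powr_ge_zero) auto
  have "L powr t = C / d + 1" unfolding L_def using C(1) d t by (simp add: powr_powr)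
  then have "C \<le> d * L powr t" "0 < L powr t" using C(1) d by (auto simp: field_simps)
  then have L: "C * L powr (- t) \<le> d"
    by (simp add: powr_minus_divide pos_divide_le_eq)
  \<comment> \<open>Below a dominant piece of weight less than \<open>L \<epsilon>\<close> there is nothing heavy from \<open>j\<close> levels on.\<close>
  obtain j where j: "\<kappa> ^ j < 1 / (M * \<Lambda> * L)"
    using real_arch_pow_inv[OF _ \<kappa>_less_1, of "1 / (M * \<Lambda> * L)"] M_ge_1 \<Lambda>_pos L1 by auto
  define m where "m = Suc j * M"
  show ?thesis
  proof (rule that[of "d * L powr (- t)" m])
    show "0 < d * L powr (- t)" using d L1 by simp
    show "0 < m" using M_ge_1 by (simp add: m_def)
    fix \<epsilon> :: real assume \<epsilon>: "0 < \<epsilon>" "\<epsilon> \<le> 1"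
    define F where "F = {(n, a) \<in> big_dominant \<epsilon>. wt n a < L * \<epsilon>}"
    have fin: "finite (big_dominant \<epsilon>)"
      using finite_big[OF \<epsilon>(1)] by (auto simp: big_dominant_def intro: finite_subset)
    have finF: "finite F" using fin by (auto simp: F_def intro: finite_subset)
    have "\<epsilon> powr (- q) \<le> real M * card (exits \<epsilon>)"
      using card_exits_ge[OF \<epsilon>] by simp
    also have "\<dots> \<le> real M * (N * card (big \<epsilon>))"
      using card_exits_le[OF \<epsilon>(1)] by (intro mult_left_mono) (auto simp flip: of_nat_mult)
    finally have "4 * d * \<epsilon> powr (- q) \<le> card (big \<epsilon>)"
      using M_ge_1 N_ge_2 by (simp add: d_def field_simps)
    then have "\<epsilon> powr t * (4 * d * \<epsilon> powr (- q)) \<le> \<epsilon> powr t * card (big \<epsilon>)"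
      by (rule mult_left_mono) simp
    also have "\<dots> \<le> (\<Sum>(n, a)\<in>big \<epsilon>. wt n a powr t)"
      using card_big_sum[OF \<epsilon>(1)] by (simp add: t_def)
    also have "\<dots> \<le> 2 * (\<Sum>(n, a)\<in>big_dominant \<epsilon>. wt n a powr t)"
      using sum_big_le_dominant[OF \<epsilon>(1)] by (simp add: t_def)
    finally have lower: "2 * d * \<epsilon> powr (- t) \<le> (\<Sum>(n, a)\<in>big_dominant \<epsilon>. wt n a powr t)"
      using powr_half_split(1)[OF \<epsilon>(1)] by (simp add: t_def mult_ac)
    have "(\<Sum>(n, a)\<in>big_dominant \<epsilon>. wt n a powr t)
      = (\<Sum>(n, a)\<in>big_dominant \<epsilon> - F. wt n a powr t) + (\<Sum>(n, a)\<in>F. wt n a powr t)"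
      by (rule sum.subset_diff) (use fin in \<open>auto simp: F_def\<close>)
    moreover have "(\<Sum>(n, a)\<in>big_dominant \<epsilon> - F. wt n a powr t) \<le> (\<Sum>(n, a)\<in>big (L * \<epsilon>). wt n a powr t)"
      using finite_big[of "L * \<epsilon>"] \<epsilon> L1
      by (intro sum_mono2) (auto simp: F_def big_dominant_def big_def)
    moreover have "\<dots> \<le> C * (L * \<epsilon>) powr (- t)" using \<epsilon> L1 by (intro C(2)) simp
    moreover have "\<dots> \<le> d * \<epsilon> powr (- t)"
      using mult_right_mono[OF L, of "\<epsilon> powr (- t)"] \<epsilon> L1 by (simp add: powr_mult mult_ac)
    moreover have "(\<Sum>(n, a)\<in>F. wt n a powr t) \<le> (\<Sum>(n, a)\<in>F. (L * \<epsilon>) powr t)"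
      using t by (intro sum_mono) (auto simp: F_def intro!: powr_mono2)
    ultimately have "d * \<epsilon> powr (- t) \<le> (L * \<epsilon>) powr t * card F"
      using lower by (simp add: case_prod_unfold mult_ac)
    then have "(L * \<epsilon>) powr (- t) * (d * \<epsilon> powr (- t)) \<le> (L * \<epsilon>) powr (- t) * ((L * \<epsilon>) powr t * card F)"
      by (rule mult_left_mono) simp
    also have "\<dots> = card F" using L1 \<epsilon> by (simp add: powr_minus)
    also have "(L * \<epsilon>) powr (- t) * (d * \<epsilon> powr (- t)) = d * L powr (- t) * \<epsilon> powr (- q)"
      using L1 \<epsilon> powr_half_split(2)[OF \<epsilon>(1)] by (simp add: powr_mult t_def mult_ac)
    finally have card_F: "d * L powr (- t) * \<epsilon> powr (- q) \<le> card F" .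
    have "card {(n, a) \<in> F. a \<le> z \<and> z \<le> a + \<rho> ^ n} \<le> m" for z
    proof (cases "{(n, a) \<in> F. a \<le> z \<and> z \<le> a + \<rho> ^ n} = {}")
      case True
      then show ?thesis by (simp only: card.empty)
    next
      case False
      define S where "S = {(n, a) \<in> F. a \<le> z \<and> z \<le> a + \<rho> ^ n}"
      have finS: "finite S" unfolding S_def by (rule finite_subset[OF _ finF]) auto
      define n0 where "n0 = Min (fst ` S)"
      have "n0 \<in> fst ` S" unfolding n0_def using finS False by (intro Min_in) (auto simp: S_def)
      then obtain a0 where a0: "(n0, a0) \<in> S" by auto
      have "S \<subseteq> (SIGMA n:{n0..n0 + j}. {a \<in> pos n. a \<le> z \<and> z \<le> a + \<rho> ^ n})"
      proof clarify
        fix n a assume na: "(n, a) \<in> S"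
        have ge: "n0 \<le> n" unfolding n0_def using finS na by (intro Min_le) (auto intro: rev_image_eqI)
        have "\<epsilon> \<le> wt n a" "a \<in> pos n" using na by (auto simp: S_def F_def big_dominant_def big_def)
        note \<open>\<epsilon> \<le> wt n a\<close>
        also have "wt n a \<le> M * \<Lambda> * \<kappa> ^ (n - n0) * wt n0 a0"
          by (rule dominant_controls_later[OF ge]) (use na a0 in \<open>auto simp: S_def F_def big_dominant_def\<close>)
        also have "\<dots> \<le> M * \<Lambda> * \<kappa> ^ (n - n0) * (L * \<epsilon>)"
          using a0 \<Lambda>_pos \<kappa>_pos by (intro mult_left_mono) (auto simp: S_def F_def)
        finally have "1 \<le> M * \<Lambda> * L * \<kappa> ^ (n - n0)" using \<epsilon> by (simp add: field_simps)
        then have "1 / (M * \<Lambda> * L) \<le> \<kappa> ^ (n - n0)"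
          using M_ge_1 \<Lambda>_pos L1 by (simp add: field_simps)
        then have "\<kappa> ^ j < \<kappa> ^ (n - n0)" using j by linarith
        then have "n - n0 < j"
          using power_decreasing[of j "n - n0" \<kappa>] \<kappa>_pos \<kappa>_less_1 by (meson less_imp_le not_le)
        then show "n \<in> {n0..n0 + j} \<and> a \<in> {a \<in> pos n. a \<le> z \<and> z \<le> a + \<rho> ^ n}"
          using ge na \<open>a \<in> pos n\<close> by (auto simp: S_def)
      qed
      then have "card S \<le> card (SIGMA n:{n0..n0 + j}. {a \<in> pos n. a \<le> z \<and> z \<le> a + \<rho> ^ n})"
        by (rule card_mono[rotated]) auto
      also have "\<dots> = (\<Sum>n\<in>{n0..n0 + j}. card {a \<in> pos n. a \<le> z \<and> z \<le> a + \<rho> ^ n})"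
        by (intro card_SigmaI) auto
      also have "\<dots> \<le> (\<Sum>n\<in>{n0..n0 + j}. M)" by (intro sum_mono card_containing)
      finally show ?thesis by (simp add: S_def m_def)
    qed
    then show "\<exists>F \<subseteq> big \<epsilon>. d * L powr (- t) * \<epsilon> powr (- q) \<le> card F \<and>
        (\<forall>z. card {(n, a) \<in> F. a \<le> z \<and> z \<le> a + \<rho> ^ n} \<le> m)"
      using card_F by (intro exI[of _ F]) (auto simp: F_def big_dominant_def)
  qed
qed

end

section \<open>Integrals against the self-similar measure\<close>

lemma continuous_on_infdist_powr:
  fixes \<alpha> :: "real set"
  assumes "0 < r"
  shows "continuous_on A (\<lambda>x. infdist x \<alpha> powr r)"
  using assms by (intro continuous_on_powr' continuous_intros) (auto simp: infdist_nonneg)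

locale self_similar_weights = critical_exponent +
  fixes p :: "nat \<Rightarrow> real" and r :: real and \<mu> :: "real measure"
  assumes r_pos: "0 < r" and p_nonneg: "\<And>i. i \<in> {1..N} \<Longrightarrow> 0 \<le> p i" and p_sum: "(\<Sum>i\<in>{1..N}. p i) = 1"
    and g_eq: "\<And>i. i \<in> {1..N} \<Longrightarrow> g i = \<rho> powr r * p i"
    and prob: "prob_space \<mu>" and sets_\<mu> [measurable_cong]: "sets \<mu> = sets borel"
    and self_similar: "\<And>A. A \<in> sets borel \<Longrightarrow>
      measure \<mu> A = (\<Sum>i\<in>{1..N}. p i * measure \<mu> ((\<lambda>x. \<rho> * x + b i) -` A))"
begin

sublocale prob_space \<mu> by (rule prob)

lemma space_\<mu> [simp]: "space \<mu> = UNIV"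
  using sets_eq_imp_space_eq[OF sets_\<mu>] by simp

lemma prob_UNIV [simp]: "measure \<mu> UNIV = 1"
  using prob_space by simp

lemma \<kappa>_eq: "\<kappa> = \<rho> powr r"
proof -
  have "\<kappa> = (\<Sum>i\<in>{1..N}. \<rho> powr r * p i)"
    unfolding \<kappa>_def by (intro sum.cong) (auto simp: g_eq)
  then show ?thesis using p_sum by (simp flip: sum_distrib_left)
qed

lemma power_\<rho>_powr: "(\<rho> ^ n) powr r = \<kappa> ^ n"
  by (induction n) (simp_all add: \<kappa>_eq powr_mult)

text \<open>Pulling back the set of points at distance more than \<open>R\<close> from \<open>[0,1]\<close> under any of the maps lands in the set of points at
distance more than \<open>R / \<rho>\<close>. Iterating, its measure is at most that of sets shrinking to the empty set.\<close>

lemma AE_unit_interval: "AE x in \<mu>. 0 \<le> x \<and> x \<le> 1"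
proof -
  define T where "T R = {x::real. x < - R \<or> 1 + R < x}" for R
  have T [measurable]: "T R \<in> sets borel" for R by (simp add: T_def)
  have step: "measure \<mu> (T R) \<le> measure \<mu> (T (R / \<rho>))" for R
  proof -
    have "measure \<mu> (T R) = (\<Sum>i\<in>{1..N}. p i * measure \<mu> ((\<lambda>x. \<rho> * x + b i) -` T R))"
      by (rule self_similar) simp
    also have "\<dots> \<le> (\<Sum>i\<in>{1..N}. p i * measure \<mu> (T (R / \<rho>)))"
    proof (intro sum_mono mult_left_mono p_nonneg finite_measure_mono)
      fix i assume i: "i \<in> {1..N}"
      show "(\<lambda>x. \<rho> * x + b i) -` T R \<subseteq> T (R / \<rho>)"
      proof
        fix x assume "x \<in> (\<lambda>x. \<rho> * x + b i) -` T R"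
        then have "\<rho> * x < - R \<or> \<rho> + R < \<rho> * x"
          using b_bounds[OF i] by (auto simp: T_def)
        then show "x \<in> T (R / \<rho>)" using \<rho>_pos by (auto simp: T_def field_simps)
      qed
    qed (auto simp: sets_\<mu>)
    also have "\<dots> = measure \<mu> (T (R / \<rho>))" using p_sum by (simp flip: sum_distrib_right)
    finally show ?thesis .
  qed
  have null: "measure \<mu> (T R) = 0" if R: "0 < R" for R
  proof -
    have le: "measure \<mu> (T R) \<le> measure \<mu> (T (R / \<rho> ^ n))" for n
    proof (induction n)
      case (Suc n)
      then show ?case using step[of "R / \<rho> ^ n"] by (simp add: mult.commute)
    qed simp
    have "decseq (\<lambda>n. T (R / \<rho> ^ n))"
    proof (rule decseq_SucI)
      fix n
      have "R / \<rho> ^ n \<le> R / \<rho> ^ Suc n"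
        using R \<rho>_pos \<rho>_less_1 by (intro divide_left_mono) auto
      then show "T (R / \<rho> ^ Suc n) \<subseteq> T (R / \<rho> ^ n)" by (auto simp: T_def)
    qed
    then have lim: "(\<lambda>n. measure \<mu> (T (R / \<rho> ^ n))) \<longlonglongrightarrow> measure \<mu> (\<Inter>n. T (R / \<rho> ^ n))"
      by (intro finite_Lim_measure_decseq) (auto simp: sets_\<mu>)
    have "(\<Inter>n. T (R / \<rho> ^ n)) = {}"
    proof (rule equals0I)
      fix x assume x: "x \<in> (\<Inter>n. T (R / \<rho> ^ n))"
      obtain n where n: "\<rho> ^ n < R / (\<bar>x\<bar> + 1)"
        using real_arch_pow_inv[OF _ \<rho>_less_1, of "R / (\<bar>x\<bar> + 1)"] R by auto
      then have "\<bar>x\<bar> + 1 < R / \<rho> ^ n" using \<rho>_pos R by (simp add: field_simps)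
      moreover have "x \<in> T (R / \<rho> ^ n)" using x by blast
      ultimately show False by (auto simp: T_def)
    qed
    then have "measure \<mu> (T R) \<le> 0" using lim le by (intro LIMSEQ_le_const) auto
    then show ?thesis by (simp add: measure_le_0_iff)
  qed
  have "AE x in \<mu>. \<forall>k. x \<notin> T (1 / Suc k)"
    unfolding AE_all_countable
  proof
    fix k
    show "AE x in \<mu>. x \<notin> T (1 / Suc k)"
      by (rule AE_not_in) (use null[of "1 / Suc k"] in \<open>auto simp: null_sets_def emeasure_eq_measure sets_\<mu>\<close>)
  qed
  then show ?thesis
  proof eventually_elim
    case (elim x)
    show ?case
    proof (rule ccontr)
      assume "\<not> (0 \<le> x \<and> x \<le> 1)"
      then have "0 < max (- x) (x - 1)" by auto
      then obtain k where "1 / Suc k < max (- x) (x - 1)"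
        using reals_Archimedean by (metis inverse_eq_divide)
      then have "x \<in> T (1 / Suc k)" by (auto simp: T_def max_def split: if_splits)
      then show False using elim by blast
    qed
  qed
qed

lemma integrable_continuous:
  fixes G :: "real \<Rightarrow> real"
  assumes "continuous_on UNIV G"
  shows "integrable \<mu> G"
proof -
  have "compact (G ` {0..1})"
    using assms by (intro compact_continuous_image) (auto intro: continuous_on_subset)
  then obtain B where B: "\<And>x. x \<in> {0..1} \<Longrightarrow> norm (G x) \<le> B"
    using compact_imp_bounded by (fastforce simp: bounded_iff)
  have "G \<in> borel_measurable borel" using assms by (rule borel_measurable_continuous_onI)
  moreover have "AE x in \<mu>. norm (G x) \<le> B"
    using AE_unit_interval by eventually_elim (use B in auto)
  ultimately show ?thesis by (intro integrable_const_bound[of _ B]) (auto simp: measurable_cong_sets[OF sets_\<mu> refl])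
qed

lemma self_similar_nn_integral:
  assumes "G \<in> borel_measurable borel"
  shows "(\<integral>\<^sup>+ x. G x \<partial>\<mu>) = (\<Sum>i\<in>{1..N}. ennreal (p i) * (\<integral>\<^sup>+ x. G (\<rho> * x + b i) \<partial>\<mu>))"
  using assms
proof (induction rule: borel_measurable_induct)
  case (cong f h)
  then show ?case by simp
next
  case (set A)
  have "(\<integral>\<^sup>+ x. indicator A (\<rho> * x + b i) \<partial>\<mu>) = measure \<mu> ((\<lambda>x. \<rho> * x + b i) -` A)" for i
  proof -
    have m: "(\<lambda>x. \<rho> * x + b i) -` A \<in> sets \<mu>"
      unfolding sets_\<mu> using set measurable_sets_borel[of "\<lambda>x. \<rho> * x + b i" borel A] by simp
    have "(\<integral>\<^sup>+ x. indicator A (\<rho> * x + b i) \<partial>\<mu>) = (\<integral>\<^sup>+ x. indicator ((\<lambda>x. \<rho> * x + b i) -` A) x \<partial>\<mu>)"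
      by (intro nn_integral_cong) (auto simp: indicator_def)
    also have "\<dots> = emeasure \<mu> ((\<lambda>x. \<rho> * x + b i) -` A)" by (rule nn_integral_indicator[OF m])
    finally show ?thesis by (simp add: emeasure_eq_measure)
  qed
  then have "(\<Sum>i\<in>{1..N}. ennreal (p i) * (\<integral>\<^sup>+ x. indicator A (\<rho> * x + b i) \<partial>\<mu>))
    = (\<Sum>i\<in>{1..N}. ennreal (p i * measure \<mu> ((\<lambda>x. \<rho> * x + b i) -` A)))"
    using p_nonneg by (intro sum.cong) (simp_all add: ennreal_mult)
  also have "\<dots> = ennreal (measure \<mu> A)"
    unfolding self_similar[OF set] by (intro sum_ennreal mult_nonneg_nonneg p_nonneg) auto
  finally show ?case using set by (simp add: sets_\<mu> emeasure_eq_measure)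
next
  case (mult u c)
  have "(\<lambda>x. u (\<rho> * x + b i)) \<in> borel_measurable \<mu>" "u \<in> borel_measurable \<mu>" for i
    using mult(2) by (simp_all add: measurable_cong_sets[OF sets_\<mu> refl])
  then show ?case using mult by (simp add: nn_integral_cmult sum_distrib_left mult_ac)
next
  case (add u v)
  have "(\<lambda>x. u (\<rho> * x + b i)) \<in> borel_measurable \<mu>" "u \<in> borel_measurable \<mu>" 
    "(\<lambda>x. v (\<rho> * x + b i)) \<in> borel_measurable \<mu>" "v \<in> borel_measurable \<mu>" for i
    using add(1,3) by (simp_all add: measurable_cong_sets[OF sets_\<mu> refl])
  then show ?case using add by (simp add: nn_integral_add sum.distrib distrib_left)
next
  case (seq U)
  have m: "U j \<in> borel_measurable \<mu>" "(\<lambda>x. U j (\<rho> * x + b i)) \<in> borel_measurable \<mu>" for i j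
    using seq.hyps(1)[of j] by (simp_all add: measurable_cong_sets[OF sets_\<mu> refl])
  have lim: "(\<lambda>j. U j x) \<longlonglongrightarrow> (SUP j. U j) x" for x
  proof -
    have "incseq (\<lambda>j. U j x)" using \<open>incseq U\<close> by (simp add: incseq_def le_fun_def)
    then show ?thesis using LIMSEQ_SUP by (simp add: image_comp)
  qed
  have "(\<lambda>j. \<integral>\<^sup>+ x. U j x \<partial>\<mu>) \<longlonglongrightarrow> (\<integral>\<^sup>+ x. (SUP j. U j) x \<partial>\<mu>)"
    using \<open>incseq U\<close> m(1) lim by (intro nn_integral_LIMSEQ) auto
  moreover have "(\<lambda>j. \<integral>\<^sup>+ x. U j (\<rho> * x + b i) \<partial>\<mu>) \<longlonglongrightarrow> (\<integral>\<^sup>+ x. (SUP j. U j) (\<rho> * x + b i) \<partial>\<mu>)" for i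
    using \<open>incseq U\<close> m(2) lim by (intro nn_integral_LIMSEQ) (auto simp: incseq_def le_fun_def)
  then have "(\<lambda>j. \<Sum>i\<in>{1..N}. ennreal (p i) * (\<integral>\<^sup>+ x. U j (\<rho> * x + b i) \<partial>\<mu>))
    \<longlonglongrightarrow> (\<Sum>i\<in>{1..N}. ennreal (p i) * (\<integral>\<^sup>+ x. (SUP j. U j) (\<rho> * x + b i) \<partial>\<mu>))"
    by (intro tendsto_sum ennreal_tendsto_cmult) auto
  ultimately show ?case using seq.IH LIMSEQ_unique by simp
qed

lemma self_similar_integral:
  fixes G :: "real \<Rightarrow> real"
  assumes G: "continuous_on UNIV G" "\<And>x. 0 \<le> G x"
  shows "(LINT x|\<mu>. G x) = (\<Sum>i\<in>{1..N}. p i * (LINT x|\<mu>. G (\<rho> * x + b i)))"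
proof -
  have cont: "continuous_on UNIV (\<lambda>x. G (\<rho> * x + b i))" for i
    by (rule continuous_on_compose2[OF G(1)]) (auto intro!: continuous_intros)
  have "ennreal (LINT x|\<mu>. G x) = (\<integral>\<^sup>+ x. ennreal (G x) \<partial>\<mu>)"
    using G integrable_continuous by (intro nn_integral_eq_integral[symmetric]) auto
  also have "\<dots> = (\<Sum>i\<in>{1..N}. ennreal (p i) * (\<integral>\<^sup>+ x. ennreal (G (\<rho> * x + b i)) \<partial>\<mu>))"
    by (rule self_similar_nn_integral) (use borel_measurable_continuous_onI[OF G(1)] in simp)
  also have "\<dots> = (\<Sum>i\<in>{1..N}. ennreal (p i) * ennreal (LINT x|\<mu>. G (\<rho> * x + b i)))"
    using G cont integrable_continuous by (intro sum.cong refl arg_cong2[where f = times] nn_integral_eq_integral) auto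
  also have "\<dots> = (\<Sum>i\<in>{1..N}. ennreal (p i * (LINT x|\<mu>. G (\<rho> * x + b i))))"
    using p_nonneg G(2) by (intro sum.cong) (simp_all add: ennreal_mult)
  also have "\<dots> = ennreal (\<Sum>i\<in>{1..N}. p i * (LINT x|\<mu>. G (\<rho> * x + b i)))"
    using G(2) by (intro sum_ennreal mult_nonneg_nonneg p_nonneg Bochner_Integration.integral_nonneg) auto
  finally show ?thesis
    using G(2)
    by (subst (asm) ennreal_inj)
      (auto intro!: sum_nonneg mult_nonneg_nonneg p_nonneg Bochner_Integration.integral_nonneg)
qed

text \<open>The normalization by \<open>\<kappa>\<^sup>n = \<rho>\<^bsup>nr\<^esup>\<close> makes this harmonic for the coefficients \<open>g i = \<rho>\<^sup>r p i\<close>.\<close>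

definition piece_integral :: "(real \<Rightarrow> real) \<Rightarrow> nat \<Rightarrow> real \<Rightarrow> real" where
  "piece_integral G n a = (LINT x|\<mu>. G (\<rho> ^ n * x + a)) / \<kappa> ^ n"

lemma piece_integral_harmonic:
  assumes G: "continuous_on UNIV G" "\<And>x. 0 \<le> G x"
  shows "piece_integral G n a = (\<Sum>i\<in>{1..N}. g i * piece_integral G (Suc n) (a + \<rho> ^ n * b i))"
proof -
  have cont: "continuous_on UNIV (\<lambda>x. G (\<rho> ^ n * x + a))"
    by (rule continuous_on_compose2[OF G(1)]) (auto intro!: continuous_intros)
  have "piece_integral G n a = (\<Sum>i\<in>{1..N}. p i * (LINT x|\<mu>. G (\<rho> ^ n * (\<rho> * x + b i) + a))) / \<kappa> ^ n"
    unfolding piece_integral_def by (subst self_similar_integral[OF cont G(2)]) simp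
  also have "\<dots> = (\<Sum>i\<in>{1..N}. g i * piece_integral G (Suc n) (a + \<rho> ^ n * b i))"
    unfolding sum_divide_distrib
  proof (rule sum.cong)
    fix i assume i: "i \<in> {1..N}"
    have arg: "\<rho> ^ n * (\<rho> * x + b i) + a = \<rho> ^ Suc n * x + (a + \<rho> ^ n * b i)" for x
      by (simp add: algebra_simps)
    have g: "g i = \<kappa> * p i" using g_eq[OF i] by (simp add: \<kappa>_eq)
    have scale: "p i * I / \<kappa> ^ n = \<kappa> * p i * (I / \<kappa> ^ Suc n)" for I
      using \<kappa>_pos by simp
    show "p i * (LINT x|\<mu>. G (\<rho> ^ n * (\<rho> * x + b i) + a)) / \<kappa> ^ n
      = g i * piece_integral G (Suc n) (a + \<rho> ^ n * b i)"
      unfolding piece_integral_def arg g by (rule scale)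
  qed simp
  finally show ?thesis .
qed

lemma piece_integral_nonneg: "(\<And>x. 0 \<le> G x) \<Longrightarrow> 0 \<le> piece_integral G n a"
  using \<kappa>_pos by (simp add: piece_integral_def)

lemma piece_integral_0: "piece_integral G 0 0 = (LINT x|\<mu>. G x)"
  by (simp add: piece_integral_def)

lemma wt_piece_integral_le:
  assumes G: "continuous_on UNIV G" "\<And>x. 0 \<le> G x" and a: "a \<in> pos n"
  shows "wt n a * piece_integral G n a \<le> (LINT x|\<mu>. G x)"
proof -
  have "wt n a * piece_integral G n a \<le> (\<Sum>a\<in>pos n. wt n a * piece_integral G n a)"
    using a piece_integral_nonneg[OF G(2)] by (intro member_le_sum) auto
  also have "\<dots> = piece_integral G 0 0"
    using harmonic_expansion[of n "piece_integral G" n, OF piece_integral_harmonic[OF G] order_refl]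
    by simp
  finally show ?thesis by (simp add: piece_integral_0)
qed

text \<open>Serve each exit by its left end point. On the piece the distance to it is at most \<open>\<rho>\<^sup>n\<close>, so the normalized
integral over the piece is at most one, and its weight is below \<open>\<epsilon>\<close>.\<close>

lemma quantization_upper:
  fixes \<epsilon> :: real
  assumes \<epsilon>: "0 < \<epsilon>" "\<epsilon> \<le> 1"
  obtains \<alpha> where "finite \<alpha>" "1 \<le> card \<alpha>" "card \<alpha> \<le> card (exits \<epsilon>)"
    "(LINT x|\<mu>. infdist x \<alpha> powr r) \<le> card (exits \<epsilon>) * \<epsilon>"
proof -
  define \<alpha> where "\<alpha> = snd ` exits \<epsilon>"
  define G where "G x = infdist x \<alpha> powr r" for x
  have G: "continuous_on UNIV G" "\<And>x. 0 \<le> G x"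
    unfolding G_def using continuous_on_infdist_powr[OF r_pos] by auto
  have fin: "finite (exits \<epsilon>)" using finite_exits[OF \<epsilon>(1)] .
  have "exits \<epsilon> \<noteq> {}" using card_exits_ge[OF \<epsilon>] \<epsilon>(1) by (auto simp: not_le)
  then have "\<alpha> \<noteq> {}" by (simp add: \<alpha>_def)
  obtain K where K: "\<And>n a. K \<le> n \<Longrightarrow> wt n a < \<epsilon>" using ex_small_level[OF \<epsilon>(1)] by blast
  have "(LINT x|\<mu>. G x) \<le> (\<Sum>(n, a)\<in>exits \<epsilon>. wt n a * piece_integral G n a)"
    using exit_expansion[where \<Phi> = "piece_integral G", OF \<epsilon> piece_integral_harmonic[OF G] piece_integral_nonneg[OF G(2)] K]
    by (simp add: piece_integral_0)
  also have "\<dots> \<le> (\<Sum>(n, a)\<in>exits \<epsilon>. \<epsilon> * 1)"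
  proof (rule sum_mono, clarify)
    fix n a assume na: "(n, a) \<in> exits \<epsilon>"
    then have "a \<in> \<alpha>" by (auto simp: \<alpha>_def intro: rev_image_eqI)
    have "AE x in \<mu>. G (\<rho> ^ n * x + a) \<le> \<kappa> ^ n"
      using AE_unit_interval
    proof eventually_elim
      case (elim x)
      have "infdist (\<rho> ^ n * x + a) \<alpha> \<le> dist (\<rho> ^ n * x + a) a" using \<open>a \<in> \<alpha>\<close> by (rule infdist_le)
      also have "\<dots> \<le> \<rho> ^ n * 1" using elim \<rho>_pos by (auto simp: dist_real_def intro!: mult_left_mono)
      finally have "G (\<rho> ^ n * x + a) \<le> (\<rho> ^ n) powr r"
        unfolding G_def using r_pos by (intro powr_mono2) (auto simp: infdist_nonneg)
      then show ?case by (simp add: power_\<rho>_powr)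
    qed
    moreover have "integrable \<mu> (\<lambda>x. G (\<rho> ^ n * x + a))"
      by (intro integrable_continuous continuous_on_compose2[OF G(1)]) (auto intro!: continuous_intros)
    ultimately have "(LINT x|\<mu>. G (\<rho> ^ n * x + a)) \<le> (LINT x|\<mu>. \<kappa> ^ n)"
      by (intro integral_mono_AE) auto
    then have "piece_integral G n a \<le> 1" using \<kappa>_pos by (simp add: piece_integral_def)
    then show "wt n a * piece_integral G n a \<le> \<epsilon> * 1"
      using exitsD(2)[OF na] piece_integral_nonneg[OF G(2)] \<epsilon>(1) by (intro mult_mono) auto
  qed
  also have "\<dots> = card (exits \<epsilon>) * \<epsilon>" by (simp add: case_prod_unfold)
  finally have "(LINT x|\<mu>. infdist x \<alpha> powr r) \<le> card (exits \<epsilon>) * \<epsilon>" by (simp add: G_def)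
  moreover have "finite \<alpha>" "card \<alpha> \<le> card (exits \<epsilon>)"
    unfolding \<alpha>_def using fin by (auto intro: card_image_le)
  ultimately show ?thesis using \<open>\<alpha> \<noteq> {}\<close> by (intro that[of \<alpha>]) (auto simp: Suc_le_eq card_gt_0_iff)
qed

text \<open>The \<open>r\<close>-th power of the distance to the complement of \<open>[0,1]\<close>, a lower bound for the quantization cost within
\<open>[0,1]\<close> if there is no point in this interval.\<close>

definition bump :: "real \<Rightarrow> real" where
  "bump y = max 0 (min y (1 - y)) powr r"

lemma continuous_bump: "continuous_on A bump"
  unfolding bump_def using r_pos by (intro continuous_on_powr' continuous_intros) auto

lemma bump_nonneg: "0 \<le> bump y"
  by (simp add: bump_def)

text \<open>The piece of the word \<open>1 N\<close> lies in the interior of \<open>[0,1]\<close> and has positive measure.\<close>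

lemma integral_bump_pos: "0 < (LINT x|\<mu>. bump x)"
proof -
  define a where "a = \<rho> * (1 - \<rho>)"
  have "0 + \<rho> ^ 0 * b 1 \<in> pos 1" using pos_child[of 0 0 1] one_in by simp
  then have "0 \<in> pos 1" by (simp only: b_first) simp
  then have a: "a \<in> pos 2"
    using pos_child[of 0 1 N] N_in by (simp only: b_last a_def) (simp add: numeral_2_eq_2 del: pos.simps)
  have a0: "0 < a" using \<rho>_pos \<rho>_less_1 by (simp add: a_def)
  have "AE x in \<mu>. a powr r \<le> bump (\<rho> ^ 2 * x + a)"
    using AE_unit_interval
  proof eventually_elim
    case (elim x)
    have "\<rho> ^ 2 * x \<le> \<rho> ^ 2 * 1" "0 \<le> \<rho> ^ 2 * x"
      using elim mult_left_mono[of x 1 "\<rho> ^ 2"] by auto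
    moreover have "\<rho> ^ 2 + a = \<rho>" by (simp add: a_def power2_eq_square algebra_simps)
    moreover have "a \<le> 1 * (1 - \<rho>)" unfolding a_def using \<rho>_less_1 by (intro mult_right_mono) auto
    ultimately have "a \<le> max 0 (min (\<rho> ^ 2 * x + a) (1 - (\<rho> ^ 2 * x + a)))" by auto
    then show ?case unfolding bump_def using a0 r_pos by (intro powr_mono2) auto
  qed
  moreover have "integrable \<mu> (\<lambda>x. bump (\<rho> ^ 2 * x + a))"
    by (intro integrable_continuous continuous_on_compose2[OF continuous_bump]) (auto intro!: continuous_intros)
  ultimately have "(LINT x|\<mu>. a powr r) \<le> (LINT x|\<mu>. bump (\<rho> ^ 2 * x + a))"
    by (intro integral_mono_AE) auto
  moreover have "0 < (LINT x|\<mu>. a powr r)" using a0 by simp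
  ultimately have "0 < (LINT x|\<mu>. bump (\<rho> ^ 2 * x + a))" by linarith
  then have "0 < piece_integral bump 2 a" using \<kappa>_pos by (simp add: piece_integral_def)
  then have "0 < wt 2 a * piece_integral bump 2 a" using a wt_pos_iff by simp
  then show ?thesis
    using wt_piece_integral_le[OF continuous_bump bump_nonneg a] by linarith
qed

text \<open>Each point of \<open>\<alpha>\<close> hits at most \<open>m\<close> pieces of the family. Over a piece without a point of \<open>\<alpha>\<close> the function
\<open>d(x,\<alpha>)\<^sup>r\<close> is at least the bump rescaled to the piece, whose integral is at least \<open>\<epsilon>\<close> times that of the original bump,
and at most \<open>m\<close> of the rescaled bumps overlap anywhere.\<close>

lemma quantization_lower:
  assumes F: "F \<subseteq> big \<epsilon>" and \<epsilon>: "0 < \<epsilon>"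
    and m: "\<And>z. card {(n, a) \<in> F. a \<le> z \<and> z \<le> a + \<rho> ^ n} \<le> m"
    and \<alpha>: "finite \<alpha>" "\<alpha> \<noteq> {}"
  shows "(real (card F) - m * card \<alpha>) * (\<epsilon> * (LINT x|\<mu>. bump x)) \<le> m * (LINT x|\<mu>. infdist x \<alpha> powr r)"
proof -
  have fin: "finite F" using F finite_big[OF \<epsilon>] by (rule finite_subset)
  define hit where "hit z = {(n, a) \<in> F. a \<le> z \<and> z \<le> a + \<rho> ^ n}" for z
  define free where "free = F - (\<Union>z\<in>\<alpha>. hit z)"
  have "card (\<Union>z\<in>\<alpha>. hit z) \<le> (\<Sum>z\<in>\<alpha>. card (hit z))" by (rule card_UN_le[OF \<alpha>(1)])
  also have "\<dots> \<le> (\<Sum>z\<in>\<alpha>. m)" unfolding hit_def by (intro sum_mono m)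
  finally have "card (\<Union>z\<in>\<alpha>. hit z) \<le> m * card \<alpha>" by (simp add: mult.commute)
  moreover have "card F - card (\<Union>z\<in>\<alpha>. hit z) \<le> card free"
    unfolding free_def by (rule diff_card_le_card_Diff) (auto simp: hit_def intro: finite_subset[OF _ fin] \<alpha>)
  ultimately have card_free: "real (card F) - m * card \<alpha> \<le> card free"
    by (simp flip: of_nat_mult)
  define \<psi> where "\<psi> u x = (case u of (n, a) \<Rightarrow> \<kappa> ^ n * bump ((x - a) / \<rho> ^ n))" for u x
  have \<psi>_cont: "continuous_on UNIV (\<psi> u)" for u
    unfolding \<psi>_def case_prod_unfold using \<rho>_pos
    by (intro continuous_intros continuous_on_compose2[OF continuous_bump[of UNIV]]) auto
  have \<psi>_nonneg: "0 \<le> \<psi> u x" for u x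
    using \<kappa>_pos bump_nonneg by (simp add: \<psi>_def case_prod_unfold)
  have \<psi>_eq: "\<psi> (n, a) x = max 0 (min (x - a) (a + \<rho> ^ n - x)) powr r" for n a x
  proof -
    define y where "y = (x - a) / \<rho> ^ n"
    have "x = a + \<rho> ^ n * y" using \<rho>_pos by (simp add: y_def)
    then have "x - a = \<rho> ^ n * y" "a + \<rho> ^ n - x = \<rho> ^ n * (1 - y)" by (simp_all add: algebra_simps)
    then have "max 0 (min (x - a) (a + \<rho> ^ n - x)) = \<rho> ^ n * max 0 (min ((x - a) / \<rho> ^ n) (1 - (x - a) / \<rho> ^ n))"
      using \<rho>_pos by (simp add: max_mult_distrib_left min_mult_distrib_left flip: y_def)
    then show ?thesis
      using \<rho>_pos by (simp add: \<psi>_def bump_def powr_mult power_\<rho>_powr)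
  qed
  have pointwise: "(\<Sum>u\<in>free. \<psi> u x) \<le> m * infdist x \<alpha> powr r" for x
  proof -
    have "(\<Sum>u\<in>free. \<psi> u x) = (\<Sum>u\<in>free \<inter> hit x. \<psi> u x)"
    proof (rule sum.mono_neutral_right)
      show "\<forall>u\<in>free - free \<inter> hit x. \<psi> u x = 0"
      proof
        fix u assume u: "u \<in> free - free \<inter> hit x"
        obtain n a where na: "u = (n, a)" by (cases u)
        have "max 0 (min (x - a) (a + \<rho> ^ n - x)) = 0" using u by (auto simp: na free_def hit_def)
        then show "\<psi> u x = 0" by (simp add: na \<psi>_eq)
      qed
    qed (use fin in \<open>auto simp: free_def\<close>)
    also have "\<dots> \<le> (\<Sum>u\<in>free \<inter> hit x. infdist x \<alpha> powr r)"
    proof (rule sum_mono, clarify)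
      fix n a assume u: "(n, a) \<in> free" "(n, a) \<in> hit x"
      have "max 0 (min (x - a) (a + \<rho> ^ n - x)) \<le> infdist x \<alpha>"
        unfolding infdist_notempty[OF \<alpha>(2)]
      proof (rule cINF_greatest[OF \<alpha>(2)])
        fix z assume "z \<in> \<alpha>"
        then have "(n, a) \<notin> hit z" "(n, a) \<in> F" using u(1) by (auto simp: free_def)
        then have "z < a \<or> a + \<rho> ^ n < z" by (auto simp: hit_def not_le)
        moreover have "a \<le> x" "x \<le> a + \<rho> ^ n" using u(2) by (auto simp: hit_def)
        ultimately show "max 0 (min (x - a) (a + \<rho> ^ n - x)) \<le> dist x z" by (auto simp: dist_real_def)
      qed
      then show "\<psi> (n, a) x \<le> infdist x \<alpha> powr r"
        unfolding \<psi>_eq using r_pos by (intro powr_mono2) auto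
    qed
    also have "\<dots> = card (free \<inter> hit x) * infdist x \<alpha> powr r" by simp
    also have "\<dots> \<le> m * infdist x \<alpha> powr r"
    proof -
      have "card (free \<inter> hit x) \<le> card (hit x)"
        by (rule card_mono) (auto simp: hit_def intro: finite_subset[OF _ fin])
      then have "card (free \<inter> hit x) \<le> m" using m[of x] by (simp add: hit_def)
      then show ?thesis by (intro mult_right_mono) auto
    qed
    finally show ?thesis .
  qed
  have each: "\<epsilon> * (LINT x|\<mu>. bump x) \<le> (LINT x|\<mu>. \<psi> u x)" if u: "u \<in> free" for u
  proof -
    obtain n a where na: "u = (n, a)" by (cases u)
    have a: "a \<in> pos n" "\<epsilon> \<le> wt n a" using u F by (auto simp: na free_def big_def)
    have "piece_integral (\<psi> u) n a = (LINT x|\<mu>. bump x)"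
      using \<rho>_pos \<kappa>_pos by (simp add: piece_integral_def \<psi>_def na)
    then have "wt n a * (LINT x|\<mu>. bump x) \<le> (LINT x|\<mu>. \<psi> u x)"
      using wt_piece_integral_le[OF \<psi>_cont \<psi>_nonneg a(1), of u] by simp
    moreover have "\<epsilon> * (LINT x|\<mu>. bump x) \<le> wt n a * (LINT x|\<mu>. bump x)"
      using a(2) integral_bump_pos by (intro mult_right_mono) auto
    ultimately show ?thesis by linarith
  qed
  have "(real (card F) - m * card \<alpha>) * (\<epsilon> * (LINT x|\<mu>. bump x)) \<le> card free * (\<epsilon> * (LINT x|\<mu>. bump x))"
    using card_free \<epsilon> integral_bump_pos by (intro mult_right_mono) auto
  also have "\<dots> = (\<Sum>u\<in>free. \<epsilon> * (LINT x|\<mu>. bump x))" by simp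
  also have "\<dots> \<le> (\<Sum>u\<in>free. (LINT x|\<mu>. \<psi> u x))" by (intro sum_mono each)
  also have "\<dots> = (LINT x|\<mu>. (\<Sum>u\<in>free. \<psi> u x))"
    by (intro Bochner_Integration.integral_sum[symmetric] integrable_continuous \<psi>_cont)
  also have "\<dots> \<le> (LINT x|\<mu>. m * infdist x \<alpha> powr r)"
    by (intro integral_mono pointwise integrable_continuous continuous_intros \<psi>_cont continuous_on_infdist_powr r_pos)
  finally show ?thesis by simp
qed

end

section \<open>From quantization errors to the quantization dimension\<close>

lemma quantization_error_nonneg:
  assumes "1 \<le> k"
  shows "0 \<le> quantization_error k r \<nu>"
proof -
  have "{\<alpha> :: real set. finite \<alpha> \<and> 1 \<le> card \<alpha> \<and> card \<alpha> \<le> k} \<noteq> {}"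
    using assms by (auto intro!: exI[of _ "{0}"])
  then show ?thesis unfolding quantization_error_def by (rule cINF_greatest) simp
qed

lemma quantization_error_powr_le:
  assumes "0 < r" "finite \<alpha>" "1 \<le> card \<alpha>" "card \<alpha> \<le> k"
  shows "quantization_error k r \<nu> powr r \<le> (LINT x|\<nu>. infdist x \<alpha> powr r)"
proof -
  have I: "0 \<le> (LINT x|\<nu>. infdist x \<alpha> powr r)" by (rule Bochner_Integration.integral_nonneg) simp
  have "quantization_error k r \<nu> \<le> (LINT x|\<nu>. infdist x \<alpha> powr r) powr (1 / r)"
    unfolding quantization_error_def
    by (rule cINF_lower) (use assms in \<open>auto intro!: bdd_belowI[of _ 0]\<close>)
  then have "quantization_error k r \<nu> powr r \<le> ((LINT x|\<nu>. infdist x \<alpha> powr r) powr (1 / r)) powr r"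
    using assms quantization_error_nonneg[of k] by (intro powr_mono2) auto
  also have "\<dots> = (LINT x|\<nu>. infdist x \<alpha> powr r)"
    using assms(1) I by (simp add: powr_powr)
  finally show ?thesis .
qed

lemma quantization_error_powr_ge:
  assumes "0 < r" "1 \<le> k" "0 \<le> v"
    and "\<And>\<alpha>. finite \<alpha> \<Longrightarrow> 1 \<le> card \<alpha> \<Longrightarrow> card \<alpha> \<le> k \<Longrightarrow> v \<le> (LINT x|\<nu>. infdist x \<alpha> powr r)"
  shows "v \<le> quantization_error k r \<nu> powr r"
proof -
  have "{\<alpha> :: real set. finite \<alpha> \<and> 1 \<le> card \<alpha> \<and> card \<alpha> \<le> k} \<noteq> {}"
    using assms(2) by (auto intro!: exI[of _ "{0}"])
  then have "v powr (1 / r) \<le> quantization_error k r \<nu>"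
    unfolding quantization_error_def using assms by (intro cINF_greatest powr_mono2) auto
  then have "(v powr (1 / r)) powr r \<le> quantization_error k r \<nu> powr r"
    using assms(1) by (intro powr_mono2) auto
  then show ?thesis using assms(1,3) by (simp add: powr_powr)
qed

text \<open>Taking logarithms, \<open>- r ln e\<^sub>k\<close> differs from \<open>(r/s) ln k\<close> by a bounded amount, which is negligible against \<open>ln k\<close>.\<close>

lemma quantization_dim_eq_of_bounds:
  assumes s: "0 < s" and r: "0 < r" and c: "0 < c"
    and bounds: "\<forall>\<^sub>F k in sequentially. c \<le> real k powr (r / s) * quantization_error k r \<nu> powr r
      \<and> real k powr (r / s) * quantization_error k r \<nu> powr r \<le> C"
  shows "quantization_dim r \<nu> = s"
proof -
  define e where "e k = quantization_error k r \<nu>" for k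
  have ln_top: "filterlim (\<lambda>k. r * ln (real k)) at_top sequentially"
    using r by (intro filterlim_tendsto_pos_mult_at_top[OF tendsto_const]
        filterlim_compose[OF ln_at_top filterlim_real_sequentially])
  have lim: "(\<lambda>k. 1 / s - ln d / (r * ln (real k))) \<longlonglongrightarrow> 1 / s" for d
    using tendsto_diff[OF tendsto_const tendsto_divide_0[OF tendsto_const filterlim_at_top_imp_at_infinity[OF ln_top]], of "1 / s" "ln d"]
    by simp
  have "\<forall>\<^sub>F k in sequentially. 1 / s - ln C / (r * ln (real k)) \<le> - ln (e k) / ln (real k)
      \<and> - ln (e k) / ln (real k) \<le> 1 / s - ln c / (r * ln (real k))"
    using bounds eventually_gt_at_top[of 1]
  proof eventually_elim
    case (elim k)
    have k: "0 < ln (real k)" "0 < real k" using elim(2) by auto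
    have "0 < real k powr (r / s) * e k powr r" using elim(1) c by (simp add: e_def)
    then have "e k \<noteq> 0" by auto
    then have e: "0 < e k" using quantization_error_nonneg[of k r \<nu>] elim(2) by (simp add: e_def)
    have "ln (real k powr (r / s) * e k powr r) = (r / s) * ln (real k) + r * ln (e k)"
      using k e by (simp add: ln_mult ln_powr)
    then have "ln c \<le> (r / s) * ln (real k) + r * ln (e k)" "(r / s) * ln (real k) + r * ln (e k) \<le> ln C"
      using ln_mono[of c "real k powr (r / s) * e k powr r"] ln_mono[of "real k powr (r / s) * e k powr r" C]
        elim(1) c by (auto simp: e_def)
    moreover have "- ln (e k) / ln (real k)
      = 1 / s - ((r / s) * ln (real k) + r * ln (e k)) / (r * ln (real k))"
      using k r s by (simp add: field_simps)
    ultimately show ?case using k r by (auto intro!: divide_right_mono)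
  qed
  then have "(\<lambda>k. - ln (e k) / ln (real k)) \<longlonglongrightarrow> 1 / s"
    by (intro tendsto_sandwich[OF _ _ lim[of C] lim[of c]]) (auto elim: eventually_mono)
  then have "(\<lambda>k. inverse (- ln (e k) / ln (real k))) \<longlonglongrightarrow> inverse (1 / s)"
    using s by (intro tendsto_inverse) auto
  then have "(\<lambda>k. ereal (ln (real k) / - ln (e k))) \<longlonglongrightarrow> ereal s"
    by simp
  then show ?thesis
    by (intro quantization_dim_eqI)
      (auto simp: lower_quantization_dim_def upper_quantization_dim_def e_def
        intro!: lim_imp_Liminf lim_imp_Limsup)
qed

context self_similar_weights
begin

text \<open>Choose \<open>\<epsilon>\<close> such that the bound on the number of exits equals the number \<open>k\<close> of available points.\<close>

lemma quantization_error_upper: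
  obtains C where "0 < C"
    "\<forall>\<^sub>F k in sequentially. real k powr (1 / q - 1) * quantization_error k r \<mu> powr r \<le> C"
proof -
  obtain C where C: "0 < C" "\<And>\<epsilon>. 0 < \<epsilon> \<Longrightarrow> card (exits \<epsilon>) \<le> C * \<epsilon> powr (- q)"
    using card_exits_bound by blast
  have "\<forall>\<^sub>F k in sequentially. C + 1 \<le> real k"
    using filterlim_real_sequentially by (simp add: filterlim_at_top)
  then have "\<forall>\<^sub>F k in sequentially. real k powr (1 / q - 1) * quantization_error k r \<mu> powr r \<le> C powr (1 / q)"
  proof eventually_elim
    case (elim k)
    then have k: "0 < real k" "C \<le> real k" using C(1) by auto
    define \<epsilon> where "\<epsilon> = (C / k) powr (1 / q)"
    have \<epsilon>: "0 < \<epsilon>" "\<epsilon> \<le> 1" using k C(1) q_pos by (auto simp: \<epsilon>_def intro!: powr_le1)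
    have "\<epsilon> powr (- q) = k / C" using k C(1) q_pos by (simp add: \<epsilon>_def powr_powr powr_minus)
    then have card: "card (exits \<epsilon>) \<le> real k" using C(2)[OF \<epsilon>(1)] C(1) by simp
    obtain \<alpha> where \<alpha>: "finite \<alpha>" "1 \<le> card \<alpha>" "card \<alpha> \<le> card (exits \<epsilon>)"
      "(LINT x|\<mu>. infdist x \<alpha> powr r) \<le> card (exits \<epsilon>) * \<epsilon>"
      using quantization_upper[OF \<epsilon>] by blast
    have "quantization_error k r \<mu> powr r \<le> (LINT x|\<mu>. infdist x \<alpha> powr r)"
      using \<alpha> card by (intro quantization_error_powr_le r_pos) auto
    also note \<alpha>(4)
    also have "card (exits \<epsilon>) * \<epsilon> \<le> k * \<epsilon>" by (rule mult_right_mono[OF card]) (use \<epsilon> in simp)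
    finally have "real k powr (1 / q - 1) * quantization_error k r \<mu> powr r \<le> real k powr (1 / q - 1) * (k * \<epsilon>)"
      by (rule mult_left_mono) simp
    also have "\<dots> = C powr (1 / q)"
      using k C(1) by (simp add: \<epsilon>_def powr_divide powr_diff)
    finally show ?case .
  qed
  then show ?thesis using C(1) by (intro that[of "C powr (1 / q)"]) auto
qed

text \<open>Choose \<open>\<epsilon>\<close> such that the separated family has at least \<open>2 m k\<close> members: \<open>k\<close> points hit at most \<open>m k\<close> of them, and
at least \<open>m k\<close> remain.\<close>

lemma quantization_error_lower:
  obtains c where "0 < c"
    "\<forall>\<^sub>F k in sequentially. c \<le> real k powr (1 / q - 1) * quantization_error k r \<mu> powr r"
proof -
  obtain c m where c: "0 < c" "0 < (m::nat)"
    "\<And>\<epsilon>. 0 < \<epsilon> \<Longrightarrow> \<epsilon> \<le> 1 \<Longrightarrow> \<exists>F \<subseteq> big \<epsilon>. c * \<epsilon> powr (- q) \<le> card F \<and>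
      (\<forall>z. card {(n, a) \<in> F. a \<le> z \<and> z \<le> a + \<rho> ^ n} \<le> m)"
    using ex_separated_family by blast
  define I where "I = (LINT x|\<mu>. bump x)"
  have I: "0 < I" unfolding I_def by (rule integral_bump_pos)
  define d where "d = c / (2 * m)"
  have d: "0 < d" using c by (simp add: d_def)
  have "\<forall>\<^sub>F k in sequentially. d + 1 \<le> real k"
    using filterlim_real_sequentially by (simp add: filterlim_at_top)
  then have "\<forall>\<^sub>F k in sequentially. d powr (1 / q) * I \<le> real k powr (1 / q - 1) * quantization_error k r \<mu> powr r"
  proof eventually_elim
    case (elim k)
    then have k: "0 < real k" "d \<le> real k" using d by auto
    define \<epsilon> where "\<epsilon> = (d / k) powr (1 / q)"
    have \<epsilon>: "0 < \<epsilon>" "\<epsilon> \<le> 1" using k d q_pos by (auto simp: \<epsilon>_def intro!: powr_le1)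
    have "\<epsilon> powr (- q) = k / d" using k d q_pos by (simp add: \<epsilon>_def powr_powr powr_minus)
    then have eq: "c * \<epsilon> powr (- q) = 2 * m * k" using c by (simp add: d_def)
    obtain F where F: "F \<subseteq> big \<epsilon>" "2 * m * k \<le> real (card F)"
      "\<And>z. card {(n, a) \<in> F. a \<le> z \<and> z \<le> a + \<rho> ^ n} \<le> m"
      using c(3)[OF \<epsilon>] unfolding eq by auto
    have "k * \<epsilon> * I \<le> quantization_error k r \<mu> powr r"
    proof (rule quantization_error_powr_ge[OF r_pos])
      fix \<alpha> :: "real set" assume \<alpha>: "finite \<alpha>" "1 \<le> card \<alpha>" "card \<alpha> \<le> k"
      have "real m * card \<alpha> \<le> real m * k" using \<alpha>(3) by (intro mult_left_mono) auto
      then have "real m * k \<le> real (card F) - m * card \<alpha>" using F(2) by simp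
      then have "real m * k * (\<epsilon> * I) \<le> (real (card F) - m * card \<alpha>) * (\<epsilon> * I)"
        using \<epsilon> I by (intro mult_right_mono) auto
      also have "\<dots> \<le> m * (LINT x|\<mu>. infdist x \<alpha> powr r)"
        unfolding I_def using \<alpha> by (intro quantization_lower[OF F(1) \<epsilon>(1) F(3)]) auto
      finally show "k * \<epsilon> * I \<le> (LINT x|\<mu>. infdist x \<alpha> powr r)"
        using c(2) by (simp add: mult_ac)
    qed (use k \<epsilon> I in auto)
    then have "real k powr (1 / q - 1) * (k * \<epsilon> * I) \<le> real k powr (1 / q - 1) * quantization_error k r \<mu> powr r"
      by (rule mult_left_mono) simp
    moreover have "real k powr (1 / q - 1) * (k * \<epsilon> * I) = d powr (1 / q) * I"
      using k d by (simp add: \<epsilon>_def powr_divide powr_diff)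
    ultimately show ?case by simp
  qed
  then show ?thesis using d I by (intro that[of "d powr (1 / q) * I"]) auto
qed

text \<open>The choice of \<open>s\<close> makes \<open>r / s = 1 / q - 1\<close>, so the two error bounds hold with exactly the exponent that occurs in the
definition of the coefficients.\<close>

lemma quantization_coeff_bounds:
  "0 < lower_quantization_coeff r (quantization_dim r \<mu>) \<mu>"
  "upper_quantization_coeff r (quantization_dim r \<mu>) \<mu> < \<infinity>"
proof -
  define s where "s = r * q / (1 - q)"
  have s: "0 < s" using r_pos q_pos q_less_1 by (simp add: s_def)
  have rs: "r / s = 1 / q - 1" using r_pos q_pos q_less_1 by (simp add: s_def field_simps)
  obtain c where c: "0 < c"
    "\<forall>\<^sub>F k in sequentially. c \<le> real k powr (r / s) * quantization_error k r \<mu> powr r"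
    using quantization_error_lower unfolding rs by blast
  obtain C where C: "0 < C"
    "\<forall>\<^sub>F k in sequentially. real k powr (r / s) * quantization_error k r \<mu> powr r \<le> C"
    using quantization_error_upper unfolding rs by blast
  have dim: "quantization_dim r \<mu> = s"
    by (rule quantization_dim_eq_of_bounds[OF s r_pos c(1) eventually_conj[OF c(2) C(2)]])
  have "ereal c \<le> lower_quantization_coeff r s \<mu>"
    unfolding lower_quantization_coeff_def by (rule Liminf_bounded) (use c(2) in simp)
  moreover have "upper_quantization_coeff r s \<mu> \<le> ereal C"
    unfolding upper_quantization_coeff_def by (rule Limsup_bounded) (use C(2) in simp)
  ultimately show "0 < lower_quantization_coeff r (quantization_dim r \<mu>) \<mu>"
    "upper_quantization_coeff r (quantization_dim r \<mu>) \<mu> < \<infinity>"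
    unfolding dim using c(1) less_le_trans[of 0 "ereal c"] le_less_trans[of _ "ereal C" \<infinity>] by auto
qed

end

section \<open>Iterated function systems of finite type\<close>

lemma word_map_snoc: "word_map f (\<sigma> @ [i]) x = word_map f \<sigma> (f i x)"
  by (induction \<sigma>) (simp_all add: word_map_def)

lemma word_map_affine:
  assumes "\<And>i x. i \<in> {1..N} \<Longrightarrow> f i x = \<rho> * x + b i" and "set \<sigma> \<subseteq> {1..N}"
  shows "word_map f \<sigma> x = \<rho> ^ length \<sigma> * x + word_map f \<sigma> (0::real)"
  using assms(2)
proof (induction \<sigma>)
  case (Cons i \<sigma>)
  have step: "word_map f (i # \<sigma>) y = \<rho> * word_map f \<sigma> y + b i" for y
    using Cons.prems assms(1) by (simp add: word_map_def)
  show ?case unfolding step using Cons by (simp add: algebra_simps)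
qed (simp add: word_map_def)

context weighted_translations
begin

lemma pos_subset_word_map:
  assumes f: "\<And>i x. i \<in> {1..N} \<Longrightarrow> f i x = \<rho> * x + b i"
  shows "a \<in> pos n \<Longrightarrow> \<exists>\<sigma>\<in>words N n. word_map f \<sigma> 0 = a"
proof (induction n arbitrary: a)
  case 0
  then show ?case by (auto simp: words_def word_map_def)
next
  case (Suc n)
  then obtain i c where i: "i \<in> {1..N}" "c \<in> pos n" "a = c + \<rho> ^ n * b i" by auto
  then obtain \<sigma> where \<sigma>: "\<sigma> \<in> words N n" "word_map f \<sigma> 0 = c" using Suc.IH by blast
  have "word_map f (\<sigma> @ [i]) 0 = word_map f \<sigma> (b i)"
    using f[OF i(1)] by (simp add: word_map_snoc)
  also have "\<dots> = a"
    using word_map_affine[where \<sigma> = \<sigma> and x = "b i", OF f] \<sigma> i(3) by (simp add: words_def)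
  finally show ?case using \<sigma>(1) i(1) by (intro bexI[of _ "\<sigma> @ [i]"]) (auto simp: words_def)
qed

text \<open>The positions of the pieces meeting a given one are \<open>a \<plusminus> \<rho>\<^sup>n \<gamma>\<close> with \<open>\<gamma>\<close> from the finite set \<open>\<Gamma>\<close>. The
additional one is for level \<open>0\<close>, of which the finite-type condition does not speak.\<close>

lemma finite_type_imp_bounded_overlap:
  assumes f: "\<And>i x. i \<in> {1..N} \<Longrightarrow> f i x = \<rho> * x + b i" and "finite_type N \<rho> f"
  obtains M where "\<And>n a. a \<in> pos n \<Longrightarrow> card {c \<in> pos n. \<bar>c - a\<bar> \<le> \<rho> ^ n} \<le> M"
proof -
  obtain \<Gamma> :: "real set" where \<Gamma>: "finite \<Gamma>"
    "\<And>n \<sigma> \<omega>. 1 \<le> n \<Longrightarrow> \<sigma> \<in> words N n \<Longrightarrow> \<omega> \<in> words N n \<Longrightarrow>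
      \<bar>word_map f \<sigma> 0 - word_map f \<omega> 0\<bar> / \<rho> ^ n \<in> \<Gamma> \<or> \<bar>word_map f \<sigma> 0 - word_map f \<omega> 0\<bar> / \<rho> ^ n > 1"
    using assms(2) unfolding finite_type_def by blast
  show ?thesis
  proof (rule that[of "2 * card \<Gamma> + 1"])
    fix n a assume a: "a \<in> pos n"
    show "card {c \<in> pos n. \<bar>c - a\<bar> \<le> \<rho> ^ n} \<le> 2 * card \<Gamma> + 1"
    proof (cases "n = 0")
      case True
      then have "card {c \<in> pos n. \<bar>c - a\<bar> \<le> \<rho> ^ n} \<le> card {0::real}" by (intro card_mono) auto
      then show ?thesis by simp
    next
      case False
      have r: "0 < \<rho> ^ n" using \<rho>_pos by simp
      have "{c \<in> pos n. \<bar>c - a\<bar> \<le> \<rho> ^ n} \<subseteq> (\<lambda>\<gamma>. a + \<rho> ^ n * \<gamma>) ` \<Gamma> \<union> (\<lambda>\<gamma>. a - \<rho> ^ n * \<gamma>) ` \<Gamma>"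
      proof
        fix c assume c: "c \<in> {c \<in> pos n. \<bar>c - a\<bar> \<le> \<rho> ^ n}"
        obtain \<sigma> \<omega> where "\<sigma> \<in> words N n" "word_map f \<sigma> 0 = c" "\<omega> \<in> words N n" "word_map f \<omega> 0 = a"
          using pos_subset_word_map[OF f] a c by blast
        then have "\<bar>c - a\<bar> / \<rho> ^ n \<in> \<Gamma> \<or> \<bar>c - a\<bar> / \<rho> ^ n > 1" using \<Gamma>(2)[of n \<sigma> \<omega>] False by auto
        moreover have "\<bar>c - a\<bar> / \<rho> ^ n \<le> 1" using c r by simp
        ultimately have "\<bar>c - a\<bar> / \<rho> ^ n \<in> \<Gamma>" by auto
        moreover have "c = a + \<rho> ^ n * (\<bar>c - a\<bar> / \<rho> ^ n) \<or> c = a - \<rho> ^ n * (\<bar>c - a\<bar> / \<rho> ^ n)"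
          using \<rho>_pos by (auto simp: abs_if)
        ultimately show "c \<in> (\<lambda>\<gamma>. a + \<rho> ^ n * \<gamma>) ` \<Gamma> \<union> (\<lambda>\<gamma>. a - \<rho> ^ n * \<gamma>) ` \<Gamma>" by blast
      qed
      then have "card {c \<in> pos n. \<bar>c - a\<bar> \<le> \<rho> ^ n}
        \<le> card ((\<lambda>\<gamma>. a + \<rho> ^ n * \<gamma>) ` \<Gamma> \<union> (\<lambda>\<gamma>. a - \<rho> ^ n * \<gamma>) ` \<Gamma>)"
        using \<Gamma>(1) by (intro card_mono) auto
      also have "\<dots> \<le> card ((\<lambda>\<gamma>. a + \<rho> ^ n * \<gamma>) ` \<Gamma>) + card ((\<lambda>\<gamma>. a - \<rho> ^ n * \<gamma>) ` \<Gamma>)"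
        by (rule card_Un_le)
      also have "\<dots> \<le> card \<Gamma> + card \<Gamma>" using \<Gamma>(1) by (intro add_mono card_image_le)
      finally show ?thesis by simp
    qed
  qed
qed

end

theorem theorem1p1:
  fixes N :: nat and \<rho> r :: real and b p :: "nat \<Rightarrow> real"
    and f :: "nat \<Rightarrow> real \<Rightarrow> real" and E :: "real set" and \<mu> :: "real measure"
  assumes "N \<ge> 2" and "0 < \<rho>" and "\<rho> < 1"
    and "\<And>i x. i \<in> {1..N} \<Longrightarrow> f i x = \<rho> * x + b i"
    and "b 1 = 0" and "strict_mono_on {1..N} b" and "b N = 1 - \<rho>"
    and "finite_type N \<rho> f"
    and "self_similar_set N f E"
    and "\<And>i. i \<in> {1..N} \<Longrightarrow> p i > 0" and "(\<Sum>i\<in>{1..N}. p i) = 1"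
    and "self_similar_measure N f p \<mu>"
    and "totally_self_similar N f E"
    and "r > 0"
  shows "0 < lower_quantization_coeff r (quantization_dim r \<mu>) \<mu>
       \<and> lower_quantization_coeff r (quantization_dim r \<mu>) \<mu>
           \<le> upper_quantization_coeff r (quantization_dim r \<mu>) \<mu>
       \<and> upper_quantization_coeff r (quantization_dim r \<mu>) \<mu> < \<infinity>"
proof -
  define g where "g i = \<rho> powr r * p i" for i
  have ends: "1 \<in> {1..N}" "N \<in> {1..N}" using assms(1) by auto
  have f: "f i = (\<lambda>x. \<rho> * x + b i)" if "i \<in> {1..N}" for i
    using assms(4)[OF that] by blast
  interpret weighted_translations N \<rho> b g
  proof
    fix i assume i: "i \<in> {1..N}"
    show "0 \<le> b i \<and> b i \<le> 1 - \<rho>"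
      using strict_mono_on_leD[OF assms(6) ends(1) i] strict_mono_on_leD[OF assms(6) i ends(2)] i assms(5,7)
      by simp
    show "0 < g i" using assms(2,10) i by (simp add: g_def)
  next
    have "(\<Sum>i\<in>{1..N}. g i) = \<rho> powr r" using assms(11) by (simp add: g_def flip: sum_distrib_left)
    then show "(\<Sum>i\<in>{1..N}. g i) < 1" using powr_less_mono2[of r \<rho> 1] assms(2,3,14) by simp
  qed (use assms in auto)
  obtain M where M: "\<And>n a. a \<in> pos n \<Longrightarrow> card {c \<in> pos n. \<bar>c - a\<bar> \<le> \<rho> ^ n} \<le> M"
    using finite_type_imp_bounded_overlap[OF assms(4,8)] by blast
  interpret boundedly_overlapping N \<rho> b g M by standard (rule M)
  obtain q where q: "0 < q" "q < 1" "\<And>n. 1 \<le> power_sum q n \<and> power_sum q n \<le> M"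
    using ex_critical_exponent by blast
  interpret critical_exponent N \<rho> b g M q by standard (use q in auto)
  interpret self_similar_weights N \<rho> b g M q p r \<mu>
  proof (rule self_similar_weights.intro, rule critical_exponent_axioms, rule self_similar_weights_axioms.intro)
    show "prob_space \<mu>" "sets \<mu> = sets borel" using assms(12) by (auto simp: self_similar_measure_def)
    fix A :: "real set" assume "A \<in> sets borel"
    then have "measure \<mu> A = (\<Sum>i\<in>{1..N}. p i * measure \<mu> (f i -` A))"
      using assms(12) unfolding self_similar_measure_def by blast
    also have "\<dots> = (\<Sum>i\<in>{1..N}. p i * measure \<mu> ((\<lambda>x. \<rho> * x + b i) -` A))"
      by (intro sum.cong refl) (simp only: f)
    finally show "measure \<mu> A = (\<Sum>i\<in>{1..N}. p i * measure \<mu> ((\<lambda>x. \<rho> * x + b i) -` A))" .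
  qed (use assms in \<open>auto simp: g_def intro: less_imp_le\<close>)
  have "lower_quantization_coeff r (quantization_dim r \<mu>) \<mu>
    \<le> upper_quantization_coeff r (quantization_dim r \<mu>) \<mu>"
    unfolding lower_quantization_coeff_def upper_quantization_coeff_def
    by (rule Liminf_le_Limsup) simp
  then show ?thesis using quantization_coeff_bounds by blast
qed

end
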